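(* Let $\mathbf n=(n_1,\ldots,n_k)\in\mathbb N^k$ be such that there exists at least one number $n_i\ge2$, and let $t\in[0,1]$. Then there exist a Hilbert space $\mathcal H$ and a pure element $\mathbf T$ in the polyball $\mathbf B_{\mathbf n}(\mathcal H)$ such that $\mathrm{rank}(\mathbf T)=1$ and $$\mathrm{curv}(\mathbf T)=t.$$ Moreover, for each $s\in[0,1]$ there is an invariant subspace $\mathcal N$ of $F^2(H_{n_1})\otimes\cdots\otimes F^2(H_{n_k})$ with multiplicity $$m(\mathcal N)=s.$$
   Context: All Hilbert spaces are complex; $\mathbb N=\{1,2,\ldots\}$. For $X_i=(X_{i,1},\ldots,X_{i,n_i})\in B(\mathcal H)^{n_i}$ let $\Phi_{X_i}(Y)=\sum_{j=1}^{n_i}X_{i,j}YX_{i,j}^*$ for $Y\in B(\mathcal H)$. The regular polyball $\mathbf B_{\mathbf n}(\mathcal H)$ is the set of all $\mathbf X=(X_1,\ldots,X_k)$ with $X_i\in B(\mathcal H)^{n_i}$ such that every entry of $X_s$ commutes with every entry of $X_t$ whenever $s\ne t$ (entries of the same $X_s$ need not commute) and $(id-\Phi_{X_1})^{p_1}\circ\cdots\circ(id-\Phi_{X_k})^{p_k}(I)\ge0$ for all $(p_1,\ldots,p_k)\in\{0,1\}^k$. Put $\mathbf\Delta_{\mathbf X}=(id-\Phi_{X_1})\circ\cdots\circ(id-\Phi_{X_k})$. For $\mathbf T\in\mathbf B_{\mathbf n}(\mathcal H)$, $\mathrm{rank}(\mathbf T):=\mathrm{rank}[\mathbf\Delta_{\mathbf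 T}(I)]$; $\mathbf T$ is pure if $\Phi_{T_i}^{q}(I)\to0$ weakly as $q\to\infty$ for each $i$. Put $\mathcal D_{\mathbf T}=\overline{\mathbf\Delta_{\mathbf T}(I)\mathcal H}$. $F^2(H_{n_i})=\mathbb C1\oplus\bigoplus_{p\ge1}H_{n_i}^{\otimes p}$ is the full Fock space of an $n_i$-dimensional Hilbert space $H_{n_i}$ with orthonormal basis $e^i_1,\ldots,e^i_{n_i}$. $\mathbb F_{n_i}^+$ is the free unital semigroup on $n_i$ generators $g_1^i,\ldots,g_{n_i}^i$ with length $|\cdot|$; for $\alpha=g^i_{j_1}\cdots g^i_{j_p}$ put $e^i_\alpha=e^i_{j_1}\otimes\cdots\otimes e^i_{j_p}$ and $T_{i,\alpha}=T_{i,j_1}\cdots T_{i,j_p}$, while for the neutral element $e^i_\alpha=1$ and $T_{i,\alpha}=I$. Let $S_{i,j}e^i_\alpha=e^i_{g^i_j\alpha}$ and $\mathbf S_{i,j}=I\otimes\cdots\otimes S_{i,j}\otimes\cdots\otimes I$ ($S_{i,j}$ in position $i$) on $\bigotimes_{i=1}^kF^2(H_{n_i})$. An invariant subspace of $\bigotimes_iF^2(H_{n_i})$ is a closed subspace invariant under every $\mathbf S_{i,j}$. The Berezin kernel of $\mathbf T$ is $\mathbf K_{\mathbf T}:\mathcal H\to\bigotimes_{i=1}^kF^2(H_{n_i})\otimes\mathcal D_{\mathbf T}$, $$\mathbf K_{\mathbf T}h=\sum_{\beta_i\in\mathbb F_{n_i}^+,\,i=1,\ldots,k}e^1_{\beta_1}\otimes\cdots\otimes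 e^k_{\beta_k}\otimes\mathbf\Delta_{\mathbf T}(I)^{1/2}T_{1,\beta_1}^*\cdots T_{k,\beta_k}^*h.$$ $P^{(i)}_q$ is the orthogonal projection of $F^2(H_{n_i})$ onto the span of all $e^i_\alpha$ with $|\alpha|=q$. For $\mathbf T$ with trace class $\mathbf\Delta_{\mathbf T}(I)$, $$\mathrm{curv}(\mathbf T):=\lim_{m\to\infty}\frac1{\binom{m+k}{k}}\sum_{\substack{q_1\ge0,\ldots,q_k\ge0\\ q_1+\cdots+q_k\le m}}\frac{\mathrm{trace}\left[\mathbf K_{\mathbf T}^*(P^{(1)}_{q_1}\otimes\cdots\otimes P^{(k)}_{q_k}\otimes I_{\mathcal D_{\mathbf T}})\mathbf K_{\mathbf T}\right]}{\mathrm{trace}\left[P^{(1)}_{q_1}\otimes\cdots\otimes P^{(k)}_{q_k}\right]},$$ and for an invariant subspace $\mathcal N$ of $\bigotimes_iF^2(H_{n_i})$ with orthogonal projection $P_{\mathcal N}$, $$m(\mathcal N):=\lim_{m\to\infty}\frac1{\binom{m+k}{k}}\sum_{\substack{q_1\ge0,\ldots,q_k\ge0\\ q_1+\cdots+q_k\le m}}\frac{\mathrm{trace}\left[P_{\mathcal N}(P^{(1)}_{q_1}\otimes\cdots\otimes P^{(k)}_{q_k})\right]}{\mathrm{trace}\left[P^{(1)}_{q_1}\otimes\cdots\otimes P^{(k)}_{q_k}\right]}$$ (both limits exist). *)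

theory Defs
  imports "HOL-Analysis.Analysis" "HOL-Library.Function_Algebras"
begin

text \<open>
  A Hilbert space is a linear subspace of an ambient complex vector space (whose addition is the one
  of the type), together with a complete inner product on that subspace. The carrier is a set, so
  that one can quantify over Hilbert spaces inside a formula. Inner products are linear in the
  first argument. Nothing is required of the inner product outside the carrier.
\<close>

record 'a hilb =
  car :: "'a set"
  scl :: "complex \<Rightarrow> 'a \<Rightarrow> 'a"
  ip  :: "'a \<Rightarrow> 'a \<Rightarrow> complex"

definition hnorm :: "'a hilb \<Rightarrow> 'a \<Rightarrow> real" where
  "hnorm H x = sqrt (Re (ip H x x))"

locale hilbert_space = vector_space "scl H" for H :: "('a::ab_group_add) hilb" +
  assumes car_subspace: "subspace (car H)"
    and ip_commute: "\<lbrakk>x \<in> car H; y \<in> car H\<rbrakk> \<Longrightarrow> ip H x y = cnj (ip H y x)"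
    and ip_add_left: "\<lbrakk>x \<in> car H; y \<in> car H; z \<in> car H\<rbrakk>
          \<Longrightarrow> ip H (x + y) z = ip H x z + ip H y z"
    and ip_scl_left: "\<lbrakk>x \<in> car H; y \<in> car H\<rbrakk> \<Longrightarrow> ip H (scl H a x) y = a * ip H x y"
    and ip_nonneg: "x \<in> car H \<Longrightarrow> ip H x x \<in> \<real>\<^sub>\<ge>\<^sub>0"
    and ip_definite: "\<lbrakk>x \<in> car H; ip H x x = 0\<rbrakk> \<Longrightarrow> x = 0"
    and complete: "\<lbrakk>\<And>m. u m \<in> car H;
            \<And>e. e > 0 \<Longrightarrow> \<exists>M. \<forall>m\<ge>M. \<forall>l\<ge>M. hnorm H (u m - u l) < e\<rbrakk>
          \<Longrightarrow> \<exists>x\<in>car H. (\<lambda>m. hnorm H (u m - x)) \<longlonglongrightarrow> 0"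

definition hclosure :: "('a::ab_group_add) hilb \<Rightarrow> 'a set \<Rightarrow> 'a set" where
  "hclosure H S = {x \<in> car H. \<forall>e>0. \<exists>y\<in>S. hnorm H (x - y) < e}"

definition closed_subspace :: "('a::ab_group_add) hilb \<Rightarrow> 'a set \<Rightarrow> bool" where
  "closed_subspace H N \<longleftrightarrow> N \<subseteq> car H \<and> module.subspace (scl H) N \<and> hclosure H N = N"

text \<open>
  Operators are functions on the ambient types of which only the values on the carrier matter.
\<close>

definition bounded_op ::
    "('a::ab_group_add) hilb \<Rightarrow> ('b::ab_group_add) hilb \<Rightarrow> ('a \<Rightarrow> 'b) \<Rightarrow> bool" where
  "bounded_op H K A \<longleftrightarrow>
     (\<forall>x\<in>car H. A x \<in> car K) \<and>
     (\<forall>x\<in>car H. \<forall>y\<in>car H. A (x + y) = A x + A y) \<and>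
     (\<forall>a. \<forall>x\<in>car H. A (scl H a x) = scl K a (A x)) \<and>
     (\<exists>C. \<forall>x\<in>car H. hnorm K (A x) \<le> C * hnorm H x)"

definition adj :: "'a hilb \<Rightarrow> 'b hilb \<Rightarrow> ('a \<Rightarrow> 'b) \<Rightarrow> 'b \<Rightarrow> 'a" where
  "adj H K A y = (THE x. x \<in> car H \<and> (\<forall>z\<in>car H. ip K (A z) y = ip H z x))"

definition positive_op :: "'a hilb \<Rightarrow> ('a \<Rightarrow> 'a) \<Rightarrow> bool" where
  "positive_op H A \<longleftrightarrow> (\<forall>x\<in>car H. ip H (A x) x \<in> \<real>\<^sub>\<ge>\<^sub>0)"

text \<open>The positive square root is unique on the carrier.\<close>

definition op_sqrt :: "('a::ab_group_add) hilb \<Rightarrow> ('a \<Rightarrow> 'a) \<Rightarrow> 'a \<Rightarrow> 'a" where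
  "op_sqrt H A =
     (SOME B. bounded_op H H B \<and> positive_op H B \<and> (\<forall>x\<in>car H. B (B x) = A x))"

definition ortho_proj :: "('a::ab_group_add) hilb \<Rightarrow> 'a set \<Rightarrow> 'a \<Rightarrow> 'a" where
  "ortho_proj H N x = (THE y. y \<in> N \<and> (\<forall>z\<in>N. ip H (x - y) z = 0))"

definition onb :: "('a::ab_group_add) hilb \<Rightarrow> 'a set \<Rightarrow> bool" where
  "onb H E \<longleftrightarrow> E \<subseteq> car H \<and>
     (\<forall>e\<in>E. \<forall>f\<in>E. ip H e f = (if e = f then 1 else 0)) \<and>
     (\<forall>x\<in>car H. (\<forall>e\<in>E. ip H x e = 0) \<longrightarrow> x = 0)"

text \<open>
  The trace is the common value of the sum of \<open>\<langle>A e, e\<rangle>\<close> over every orthonormal basis;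
  it is meaningful for trace class operators only.
\<close>

definition op_trace :: "('a::ab_group_add) hilb \<Rightarrow> ('a \<Rightarrow> 'a) \<Rightarrow> complex" where
  "op_trace H A = (THE c. \<forall>E. onb H E \<longrightarrow> ((\<lambda>e. ip H (A e) e) has_sum c) E)"

text \<open>The library's \<^const>\<open>vector_space.dim\<close> is 0 for infinite-dimensional sets, hence the case split.\<close>

definition op_rank :: "('a::ab_group_add) hilb \<Rightarrow> ('a \<Rightarrow> 'a) \<Rightarrow> enat" where
  "op_rank H A =
     (if \<exists>B. finite B \<and> A ` car H \<subseteq> module.span (scl H) B
      then enat (vector_space.dim (scl H) (A ` car H)) else \<infinity>)"

definition complex_hilb :: "complex hilb" where
  "complex_hilb = \<lparr>car = UNIV, scl = (*), ip = (\<lambda>x y. x * cnj y)\<rparr>"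

text \<open>
  \<open>ell2 I D\<close>: square-summable families of elements of \<open>D\<close> indexed by \<open>I\<close>, extended by 0 outside
  of \<open>I\<close>. This is the Hilbert space tensor product of \<open>\<ell>\<^sup>2(I)\<close> and \<open>D\<close>; the elementary tensor of the
  basis vector at \<open>\<beta>\<close> and \<open>d\<close> is the family with value \<open>d\<close> at \<open>\<beta>\<close> and 0 elsewhere.
\<close>

definition ell2 :: "'i set \<Rightarrow> ('a::ab_group_add) hilb \<Rightarrow> ('i \<Rightarrow> 'a) hilb" where
  "ell2 I D =
     \<lparr>car = {f. (\<forall>i\<in>I. f i \<in> car D) \<and> (\<forall>i. i \<notin> I \<longrightarrow> f i = 0) \<and>
               (\<lambda>i. (hnorm D (f i))\<^sup>2) summable_on I},
      scl = (\<lambda>a f i. scl D a (f i)),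
      ip = (\<lambda>f g. \<Sum>\<^sub>\<infinity>i\<in>I. ip D (f i) (g i))\<rparr>"

text \<open>
  The tuple \<open>(n\<^sub>1, \<dots>, n\<^sub>k)\<close> is a list \<open>ns\<close> of length \<open>k\<close>. All indices start at 0: \<open>i < length ns\<close>
  and \<open>j < ns ! i\<close>. Elements of the free semigroup on \<open>n\<close> generators are lists over \<open>{..<n}\<close>.
  The full Fock space on \<open>n\<close> generators has the orthonormal basis \<open>e\<^sub>\<alpha>\<close> indexed by these words, and
  the tensor product of the Fock spaces has the orthonormal basis of all
  \<open>e\<^sub>\<beta>\<^sub>1 \<otimes> \<cdots> \<otimes> e\<^sub>\<beta>\<^sub>k\<close>, indexed by tuples of words \<open>\<beta>\<close>; its elements are represented by their
  coefficients in this basis.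
\<close>

definition words :: "nat list \<Rightarrow> nat list list set" where
  "words ns = {\<beta>. length \<beta> = length ns \<and> (\<forall>i<length ns. set (\<beta> ! i) \<subseteq> {..<ns ! i})}"

definition fock :: "nat list \<Rightarrow> (nat list list \<Rightarrow> complex) hilb" where
  "fock ns = ell2 (words ns) complex_hilb"

definition fock_basis :: "nat list list \<Rightarrow> nat list list \<Rightarrow> complex" where
  "fock_basis \<beta> = (\<lambda>\<gamma>. if \<gamma> = \<beta> then 1 else 0)"

text \<open>
  \<open>at_slot i A\<close> is \<open>I \<otimes> \<cdots> \<otimes> A \<otimes> \<cdots> \<otimes> I\<close> with \<open>A\<close> in position \<open>i\<close>. Coefficients are in an
  arbitrary type, so that this also covers a further factor \<open>\<otimes> I\<^sub>D\<close>.
\<close>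

definition at_slot ::
    "nat \<Rightarrow> ((nat list \<Rightarrow> 'b) \<Rightarrow> nat list \<Rightarrow> 'b)
      \<Rightarrow> (nat list list \<Rightarrow> 'b) \<Rightarrow> nat list list \<Rightarrow> 'b" where
  "at_slot i A F = (\<lambda>\<beta>. A (\<lambda>\<alpha>. F (\<beta>[i := \<alpha>])) (\<beta> ! i))"

definition creation :: "nat \<Rightarrow> (nat list \<Rightarrow> 'b::zero) \<Rightarrow> nat list \<Rightarrow> 'b" where
  "creation j f = (\<lambda>\<alpha>. case \<alpha> of [] \<Rightarrow> 0 | l # \<alpha>' \<Rightarrow> if l = j then f \<alpha>' else 0)"

definition level_proj :: "nat \<Rightarrow> (nat list \<Rightarrow> 'b::zero) \<Rightarrow> nat list \<Rightarrow> 'b" where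
  "level_proj q f = (\<lambda>\<alpha>. if length \<alpha> = q then f \<alpha> else 0)"

definition shift ::
    "nat \<Rightarrow> nat \<Rightarrow> (nat list list \<Rightarrow> complex) \<Rightarrow> nat list list \<Rightarrow> complex" where
  "shift i j = at_slot i (creation j)"

text \<open>The operator \<open>P\<^sub>q\<^sub>1 \<otimes> \<cdots> \<otimes> P\<^sub>q\<^sub>k\<close>, possibly tensored with an identity.\<close>

definition levels_proj ::
    "nat list \<Rightarrow> (nat list list \<Rightarrow> 'b::zero) \<Rightarrow> nat list list \<Rightarrow> 'b" where
  "levels_proj q = foldr (\<circ>) (map (\<lambda>i. at_slot i (level_proj (q ! i))) [0..<length q]) id"

lemma shift_fock_basis:
  assumes "i < length \<beta>"
  shows "shift i j (fock_basis \<beta>) = fock_basis (\<beta>[i := j # \<beta> ! i])"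
proof
  fix \<gamma>
  have *: "\<gamma>[i := \<alpha>] = \<beta> \<longleftrightarrow> \<alpha> = \<beta> ! i \<and> \<gamma> = \<beta>[i := \<gamma> ! i]" for \<alpha>
    using assms by (metis length_list_update list_update_id list_update_overwrite nth_list_update_eq)
  have **: "\<gamma> = \<beta>[i := j # \<beta> ! i] \<longleftrightarrow> \<gamma> ! i = j # \<beta> ! i \<and> \<gamma> = \<beta>[i := \<gamma> ! i]"
    using assms by (metis nth_list_update_eq)
  show "shift i j (fock_basis \<beta>) \<gamma> = fock_basis (\<beta>[i := j # \<beta> ! i]) \<gamma>"
    unfolding shift_def at_slot_def creation_def fock_basis_def * **
    by (auto split: list.split)
qed

lemma levels_proj_apply:
  "levels_proj q F \<beta> = (if \<forall>i<length q. length (\<beta> ! i) = q ! i then F \<beta> else 0)"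
proof -
  have "foldr (\<circ>) (map (\<lambda>i. at_slot i (level_proj (q ! i))) is) id F \<beta> =
      (if \<forall>i\<in>set is. length (\<beta> ! i) = q ! i then F \<beta> else 0)" for "is"
    by (induction "is") (auto simp: at_slot_def level_proj_def)
  then show ?thesis
    by (auto simp: levels_proj_def)
qed

definition invariant_subspace :: "nat list \<Rightarrow> (nat list list \<Rightarrow> complex) set \<Rightarrow> bool" where
  "invariant_subspace ns N \<longleftrightarrow> closed_subspace (fock ns) N \<and>
     (\<forall>i<length ns. \<forall>j<ns ! i. \<forall>f\<in>N. shift i j f \<in> N)"

definition multiplicity_seq ::
    "nat list \<Rightarrow> (nat list list \<Rightarrow> complex) set \<Rightarrow> nat \<Rightarrow> complex" where
  "multiplicity_seq ns N m =
     1 / of_nat ((m + length ns) choose length ns) *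
     (\<Sum>q | length q = length ns \<and> sum_list q \<le> m.
        op_trace (fock ns) (ortho_proj (fock ns) N \<circ> levels_proj q) /
        op_trace (fock ns) (levels_proj q))"

definition inv_multiplicity :: "nat list \<Rightarrow> (nat list list \<Rightarrow> complex) set \<Rightarrow> complex" where
  "inv_multiplicity ns N = lim (multiplicity_seq ns N)"

text \<open>A tuple \<open>X\<close> of tuples of operators is a function; \<open>X i j\<close> is relevant for \<open>i < length ns\<close>, \<open>j < ns ! i\<close>.\<close>

definition cp_map ::
    "('a::ab_group_add) hilb \<Rightarrow> nat \<Rightarrow> (nat \<Rightarrow> 'a \<Rightarrow> 'a) \<Rightarrow> ('a \<Rightarrow> 'a) \<Rightarrow> 'a \<Rightarrow> 'a" where
  "cp_map H n A Y = (\<lambda>h. \<Sum>j<n. A j (Y (adj H H (A j) h)))"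

definition id_minus_cp ::
    "('a::ab_group_add) hilb \<Rightarrow> nat \<Rightarrow> (nat \<Rightarrow> 'a \<Rightarrow> 'a) \<Rightarrow> ('a \<Rightarrow> 'a) \<Rightarrow> 'a \<Rightarrow> 'a" where
  "id_minus_cp H n A Y = (\<lambda>h. Y h - cp_map H n A Y h)"

definition defect_map ::
    "('a::ab_group_add) hilb \<Rightarrow> nat list \<Rightarrow> (nat \<Rightarrow> nat \<Rightarrow> 'a \<Rightarrow> 'a) \<Rightarrow> nat list
      \<Rightarrow> ('a \<Rightarrow> 'a) \<Rightarrow> 'a \<Rightarrow> 'a" where
  "defect_map H ns X p =
     foldr (\<circ>) (map (\<lambda>i. id_minus_cp H (ns ! i) (X i) ^^ (p ! i)) [0..<length ns]) id"

definition polyball ::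
    "('a::ab_group_add) hilb \<Rightarrow> nat list \<Rightarrow> (nat \<Rightarrow> nat \<Rightarrow> 'a \<Rightarrow> 'a) set" where
  "polyball H ns = {X.
     (\<forall>i<length ns. \<forall>j<ns ! i. bounded_op H H (X i j)) \<and>
     (\<forall>s<length ns. \<forall>t<length ns. s \<noteq> t \<longrightarrow>
        (\<forall>i<ns ! s. \<forall>j<ns ! t. \<forall>x\<in>car H. X s i (X t j x) = X t j (X s i x))) \<and>
     (\<forall>p. length p = length ns \<and> set p \<subseteq> {0, 1} \<longrightarrow>
        positive_op H (defect_map H ns X p (\<lambda>h. h)))}"

definition defect_op ::
    "('a::ab_group_add) hilb \<Rightarrow> nat list \<Rightarrow> (nat \<Rightarrow> nat \<Rightarrow> 'a \<Rightarrow> 'a) \<Rightarrow> 'a \<Rightarrow> 'a" where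
  "defect_op H ns T = defect_map H ns T (replicate (length ns) 1) (\<lambda>h. h)"

definition polyball_rank ::
    "('a::ab_group_add) hilb \<Rightarrow> nat list \<Rightarrow> (nat \<Rightarrow> nat \<Rightarrow> 'a \<Rightarrow> 'a) \<Rightarrow> enat" where
  "polyball_rank H ns T = op_rank H (defect_op H ns T)"

definition pure_tuple ::
    "('a::ab_group_add) hilb \<Rightarrow> nat list \<Rightarrow> (nat \<Rightarrow> nat \<Rightarrow> 'a \<Rightarrow> 'a) \<Rightarrow> bool" where
  "pure_tuple H ns T \<longleftrightarrow>
     (\<forall>i<length ns. \<forall>x\<in>car H. \<forall>y\<in>car H.
        (\<lambda>q. ip H ((cp_map H (ns ! i) (T i) ^^ q) (\<lambda>h. h) x) y) \<longlonglongrightarrow> 0)"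

definition defect_space ::
    "('a::ab_group_add) hilb \<Rightarrow> nat list \<Rightarrow> (nat \<Rightarrow> nat \<Rightarrow> 'a \<Rightarrow> 'a) \<Rightarrow> 'a hilb" where
  "defect_space H ns T = H\<lparr>car := hclosure H (defect_op H ns T ` car H)\<rparr>"

definition word_op :: "(nat \<Rightarrow> 'a \<Rightarrow> 'a) \<Rightarrow> nat list \<Rightarrow> 'a \<Rightarrow> 'a" where
  "word_op A \<alpha> = foldr (\<circ>) (map A \<alpha>) id"

definition berezin_kernel ::
    "('a::ab_group_add) hilb \<Rightarrow> nat list \<Rightarrow> (nat \<Rightarrow> nat \<Rightarrow> 'a \<Rightarrow> 'a)
      \<Rightarrow> 'a \<Rightarrow> nat list list \<Rightarrow> 'a" where
  "berezin_kernel H ns T h = (\<lambda>\<beta>.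
     if \<beta> \<in> words ns
     then op_sqrt H (defect_op H ns T)
            (foldr (\<circ>) (map (\<lambda>i. adj H H (word_op (T i) (\<beta> ! i))) [0..<length ns]) id h)
     else 0)"

definition curv_seq ::
    "('a::ab_group_add) hilb \<Rightarrow> nat list \<Rightarrow> (nat \<Rightarrow> nat \<Rightarrow> 'a \<Rightarrow> 'a) \<Rightarrow> nat \<Rightarrow> complex" where
  "curv_seq H ns T m =
     1 / of_nat ((m + length ns) choose length ns) *
     (\<Sum>q | length q = length ns \<and> sum_list q \<le> m.
        op_trace H (adj H (ell2 (words ns) (defect_space H ns T)) (berezin_kernel H ns T)
                      \<circ> levels_proj q \<circ> berezin_kernel H ns T) /
        op_trace (fock ns) (levels_proj q))"

definition curv ::
    "('a::ab_group_add) hilb \<Rightarrow> nat list \<Rightarrow> (nat \<Rightarrow> nat \<Rightarrow> 'a \<Rightarrow> 'a) \<Rightarrow> complex" where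
  "curv H ns T = lim (curv_seq H ns T)"

end

theory Submission
  imports Defs
begin

text \<open>
  Let \<open>C\<close> be a set of tuples of words that contains the empty tuple and is closed under passing to
  suffixes. The compression of the shifts to the span of the basis vectors indexed by \<open>C\<close> is a pure
  tuple whose defect operator is the projection onto the vacuum vector, and its Berezin kernel is the
  inclusion. Hence its curvature is the average over the levels \<open>q\<close> of the proportion of tuples of
  level \<open>q\<close> that belong to \<open>C\<close>. The basis vectors indexed by the complement of \<open>C\<close> span an invariant
  subspace, whose multiplicity is one minus this average. Every density \<open>t\<close> is attained: for a slot
  \<open>i\<close> with \<open>n = n\<^sub>i \<ge> 2\<close>, read the word in slot \<open>i\<close> as an \<open>n\<close>-adic expansion whose
  leading digit is the last letter and let \<open>C\<close> consist of the tuples for which this number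
  is at most \<open>t\<close>. Prepending letters can only increase the number, and the proportion of words of
  length \<open>q\<close> in \<open>C\<close> differs from \<open>t\<close> by at most \<open>n\<^sup>-\<^sup>q\<close>.
\<close>

section \<open>Parseval's identity and square roots of projections\<close>

text \<open>Two notions given by description dictate the preliminaries. The trace has to be the sum
  over every orthonormal basis, so it cannot simply be read off in the standard basis: Parseval's
  identity for arbitrary bases is required. The square root in the Berezin kernel is a choice, so
  positive roots must be shown unique; this is elementary for a projection, the only case that
  occurs. Every operator whose trace, rank or root is taken is a coordinate projection, which turns
  the rest into counting. The assumption of a slot with two generators enters because in a slot with
  one generator each level holds a single word, so that the proportion there is 0 or 1. The order of
  the digits is forced: shifts prepend letters, hence a new letter has to become the least
  significant digit. The non-strict bound by \<open>t\<close> keeps the empty word in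
  \<open>C\<close> even for \<open>t = 0\<close>, so the rank stays 1. The proportion depends only
  on the entry of \<open>q\<close> in the chosen slot and is close to \<open>t\<close> only when
  that entry is large. The averages still converge because lists \<open>q\<close> with a small entry
  there become rare.\<close>

context hilbert_space
begin

section \<open>Inner product calculus on the carrier\<close>

lemma car_zero [simp]: "0 \<in> car H"
  using car_subspace by (rule subspace_0)

lemma car_add [simp]: "x \<in> car H \<Longrightarrow> y \<in> car H \<Longrightarrow> x + y \<in> car H"
  using car_subspace by (rule subspace_add)

lemma car_diff [simp]: "x \<in> car H \<Longrightarrow> y \<in> car H \<Longrightarrow> x - y \<in> car H"
  using car_subspace by (rule subspace_diff)

lemma car_scl [simp]: "x \<in> car H \<Longrightarrow> scl H a x \<in> car H"
  using car_subspace by (rule subspace_scale)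

lemma car_sum: "(\<And>i. i \<in> F \<Longrightarrow> f i \<in> car H) \<Longrightarrow> sum f F \<in> car H"
  using car_subspace by (rule subspace_sum)

lemma ip_diff_left:
  assumes "x \<in> car H" "y \<in> car H" "z \<in> car H"
  shows "ip H (x - y) z = ip H x z - ip H y z"
  using ip_add_left[of "x - y" y z] assms by simp

lemma ip_add_right:
  assumes "x \<in> car H" "y \<in> car H" "z \<in> car H"
  shows "ip H x (y + z) = ip H x y + ip H x z"
  using assms by (metis car_add complex_cnj_add ip_add_left ip_commute)

lemma ip_diff_right:
  assumes "x \<in> car H" "y \<in> car H" "z \<in> car H"
  shows "ip H x (y - z) = ip H x y - ip H x z"
  using ip_add_right[of x "y - z" z] assms by simp

lemma ip_scl_right:
  assumes "x \<in> car H" "y \<in> car H"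
  shows "ip H x (scl H a y) = cnj a * ip H x y"
  using assms by (metis car_scl complex_cnj_mult ip_commute ip_scl_left)

lemma ip_zero_left [simp]: "x \<in> car H \<Longrightarrow> ip H 0 x = 0"
  using ip_diff_left[of 0 0 x] by simp

lemma ip_zero_right [simp]: "x \<in> car H \<Longrightarrow> ip H x 0 = 0"
  using ip_diff_right[of x 0 0] by simp

lemma ip_sum_left:
  assumes "\<And>i. i \<in> F \<Longrightarrow> f i \<in> car H" "z \<in> car H"
  shows "ip H (sum f F) z = (\<Sum>i\<in>F. ip H (f i) z)"
  using assms
proof (induction F rule: infinite_finite_induct)
  case (insert i F)
  then show ?case
    by (simp add: ip_add_left car_sum)
qed auto

lemma ip_self: "x \<in> car H \<Longrightarrow> ip H x x = complex_of_real ((hnorm H x)\<^sup>2)"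
  using ip_nonneg[of x] by (simp add: hnorm_def complex_nonneg_Reals_iff complex_eq_iff)

lemma hnorm_nonneg [simp]: "x \<in> car H \<Longrightarrow> 0 \<le> hnorm H x"
  using ip_nonneg[of x] by (auto simp: hnorm_def complex_nonneg_Reals_iff)

lemma hnorm_minus_commute:
  assumes "x \<in> car H" "y \<in> car H"
  shows "hnorm H (x - y) = hnorm H (y - x)"
  unfolding hnorm_def using assms by (simp add: ip_diff_left ip_diff_right algebra_simps)

lemma hnorm_eq_0: "x \<in> car H \<Longrightarrow> hnorm H x = 0 \<Longrightarrow> x = 0"
  using ip_definite ip_self by force

text \<open>Pythagoras: the Fourier sum \<open>p\<close> over \<open>F\<close> is the orthogonal
  projection of \<open>x\<close> onto the span of \<open>F\<close>, so \<open>x - p\<close> is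
  orthogonal to \<open>p\<close>. Bessel's inequality and all distances between partial sums below
  come from this identity.\<close>

lemma hnorm_diff_fourier_sum:
  assumes F: "finite F" "F \<subseteq> car H"
    and orth: "\<And>e f. e \<in> F \<Longrightarrow> f \<in> F \<Longrightarrow> ip H e f = (if e = f then 1 else 0)"
    and x: "x \<in> car H"
  shows "(hnorm H (x - (\<Sum>e\<in>F. scl H (ip H x e) e)))\<^sup>2 = (hnorm H x)\<^sup>2 - (\<Sum>e\<in>F. (cmod (ip H x e))\<^sup>2)"
proof -
  define p where "p = (\<Sum>e\<in>F. scl H (ip H x e) e)"
  have p: "p \<in> car H"
    unfolding p_def using F by (intro car_sum) auto
  have "ip H p f = ip H x f" if "f \<in> F" for f
  proof -
    have "ip H p f = (\<Sum>e\<in>F. ip H x e * ip H e f)"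
      unfolding p_def using F that
      by (subst ip_sum_left) (auto simp: ip_scl_left subset_iff intro!: sum.cong)
    also have "\<dots> = (\<Sum>e\<in>F. if e = f then ip H x f else 0)"
      using that by (intro sum.cong) (auto simp: orth)
    finally show ?thesis
      using F that by simp
  qed
  then have d: "ip H (x - p) f = 0" if "f \<in> F" for f
    using that x p F by (auto simp: ip_diff_left)
  have "ip H p (x - p) = (\<Sum>e\<in>F. ip H x e * ip H e (x - p))"
    unfolding p_def using F x p[unfolded p_def]
    by (subst ip_sum_left) (auto simp: ip_scl_left subset_iff intro!: sum.cong)
  also have "\<dots> = 0"
    using d F x p by (intro sum.neutral) (metis car_diff complex_cnj_zero ip_commute mult_zero_right subsetD)
  finally have "ip H (x - p) (x - p) = ip H x (x - p)"
    using x p by (simp add: ip_diff_left)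
  also have "\<dots> = ip H x x - ip H x p"
    using x p by (simp add: ip_diff_right)
  also have "ip H x p = cnj (ip H p x)"
    using x p by (rule ip_commute)
  also have "ip H p x = (\<Sum>e\<in>F. ip H x e * cnj (ip H x e))"
  proof -
    have "ip H (scl H (ip H x e) e) x = ip H x e * cnj (ip H x e)" if "e \<in> F" for e
    proof -
      have "e \<in> car H"
        using that F by auto
      then show ?thesis
        using x ip_commute[of e x] by (simp add: ip_scl_left)
    qed
    then show ?thesis
      unfolding p_def using F x by (subst ip_sum_left) auto
  qed
  also have "\<dots> = complex_of_real (\<Sum>e\<in>F. (cmod (ip H x e))\<^sup>2)"
    by (simp only: complex_norm_square of_real_sum)
  finally have "complex_of_real ((hnorm H (x - p))\<^sup>2)
      = complex_of_real ((hnorm H x)\<^sup>2 - (\<Sum>e\<in>F. (cmod (ip H x e))\<^sup>2))"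
    using x p by (simp add: ip_self)
  then show ?thesis
    unfolding p_def using of_real_eq_iff by blast
qed

text \<open>The Cauchy-Schwarz inequality against a unit vector: the squared distance from
  \<open>x\<close> to its Fourier sum over \<open>{e}\<close> is nonnegative.\<close>

lemma cmod_ip_le:
  assumes "x \<in> car H" "e \<in> car H" "ip H e e = 1"
  shows "cmod (ip H x e) \<le> hnorm H x"
  using hnorm_diff_fourier_sum[of "{e}" x] assms zero_le_power2[of "hnorm H (x - scl H (ip H x e) e)"]
  by (auto intro: power2_le_imp_le[of "cmod (ip H x e)"])

text \<open>\<open>onb\<close> only states that no nonzero vector is orthogonal to \<open>E\<close>,
  so completeness has to supply the expansion of \<open>x\<close>. The basis may be uncountable; a
  sequence of finite subsets that exhausts the sum \<open>S\<close> of the squared coefficients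
  reduces the matter to Cauchy sequences. Their limit \<open>y\<close> has the same coefficients as
  \<open>x\<close>, hence equals \<open>x\<close>, and the distance formula then forces
  \<open>S\<close> to be the squared norm.\<close>

lemma Parseval:
  assumes E: "onb H E" and x: "x \<in> car H"
  shows "((\<lambda>e. (cmod (ip H x e))\<^sup>2) has_sum (hnorm H x)\<^sup>2) E"
proof -
  define f where "f = (\<lambda>e. (cmod (ip H x e))\<^sup>2)"
  define p where "p = (\<lambda>F. \<Sum>e\<in>F. scl H (ip H x e) e)"
  have sub: "E \<subseteq> car H" and orth: "\<And>e f. e \<in> E \<Longrightarrow> f \<in> E \<Longrightarrow> ip H e f = (if e = f then 1 else 0)"
    and total: "\<And>y. y \<in> car H \<Longrightarrow> (\<forall>e\<in>E. ip H y e = 0) \<Longrightarrow> y = 0"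
    using E by (auto simp: onb_def)
  have p_car: "p F \<in> car H" if "F \<subseteq> E" for F
    unfolding p_def using that sub by (intro car_sum) auto
  have dist: "(hnorm H (x - p F))\<^sup>2 = (hnorm H x)\<^sup>2 - sum f F" if "finite F" "F \<subseteq> E" for F
    unfolding p_def f_def using that sub orth x by (intro hnorm_diff_fourier_sum) (auto simp: subset_iff)
  have bessel: "sum f F \<le> (hnorm H x)\<^sup>2" if "finite F" "F \<subseteq> E" for F
    using dist[OF that] by (metis diff_ge_0_iff_ge zero_le_power2)
  have summable: "f summable_on E"
    using bessel by (intro nonneg_bdd_above_summable_on) (auto simp: f_def intro!: bdd_aboveI2)
  define S where "S = infsum f E"
  have S: "(f has_sum S) E"
    unfolding S_def using summable by (rule has_sum_infsum)
  have le_S: "sum f F \<le> S" if "finite F" "F \<subseteq> E" for F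
    unfolding S_def using that summable by (intro finite_sum_le_infsum) (auto simp: f_def)
  have "\<exists>F. finite F \<and> F \<subseteq> E \<and> S - sum f F < 1 / real (Suc n)" for n
  proof -
    have "eventually (\<lambda>F. S - 1 / real (Suc n) < sum f F) (finite_subsets_at_top E)"
      using S unfolding has_sum_def by (rule order_tendstoD) simp
    then show ?thesis
      unfolding eventually_finite_subsets_at_top by (metis diff_less_eq add.commute order_refl)
  qed
  then obtain F where F: "\<And>n. finite (F n)" "\<And>n. F n \<subseteq> E" "\<And>n. S - sum f (F n) < 1 / real (Suc n)"
    by metis
  \<comment> \<open>Unions make the finite sets increasing, so that for \<open>m \<le> n\<close> the
    vector \<open>u m\<close> is the Fourier sum over \<open>G m\<close> not only of
    \<open>x\<close> but also of \<open>u n\<close>. Pythagoras then applies with \<open>u n\<close>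
    in place of \<open>x\<close>.\<close>
  define G where "G = (\<lambda>n. \<Union>i\<le>n. F i)"
  have G: "finite (G n)" "G n \<subseteq> E" for n
    using F by (auto simp: G_def)
  have G_mono: "G m \<subseteq> G n" if "m \<le> n" for m n
    unfolding G_def using that by (intro UN_mono) auto
  have G_S: "S - sum f (G n) < 1 / real (Suc n)" for n
  proof -
    have "sum f (F n) \<le> sum f (G n)"
      using F G by (intro sum_mono2) (auto simp: G_def f_def)
    then show ?thesis
      using F(3)[of n] by linarith
  qed
  define u where "u = (\<lambda>n. p (G n))"
  have u: "u n \<in> car H" for n
    unfolding u_def using G by (intro p_car) auto
  have ip_u: "ip H (u n) e = (if e \<in> G n then ip H x e else 0)" if "e \<in> E" for n e
  proof -
    have "ip H (u n) e = (\<Sum>g\<in>G n. ip H x g * ip H g e)"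
      unfolding u_def p_def using G[of n] that sub
      by (subst ip_sum_left) (auto simp: ip_scl_left subset_iff intro!: sum.cong)
    also have "\<dots> = (\<Sum>g\<in>G n. if g = e then ip H x e else 0)"
      using that G[of n] by (intro sum.cong) (auto simp: orth)
    finally show ?thesis
      using G[of n] by simp
  qed
  have ip_u_G: "ip H (u n) e = ip H x e" if "e \<in> G m" "m \<le> n" for m n e
    using ip_u[of e n] G(2)[of m] G_mono[OF that(2)] that(1) by (metis subsetD)
  have dist_u: "(hnorm H (u n - u m))\<^sup>2 = (hnorm H (u n))\<^sup>2 - sum f (G m)" if "m \<le> n" for m n
  proof -
    have "(hnorm H (u n - (\<Sum>e\<in>G m. scl H (ip H (u n) e) e)))\<^sup>2
        = (hnorm H (u n))\<^sup>2 - (\<Sum>e\<in>G m. (cmod (ip H (u n) e))\<^sup>2)"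
      using G[of m] sub orth u by (intro hnorm_diff_fourier_sum) (auto simp: subset_iff)
    also have "(\<Sum>e\<in>G m. scl H (ip H (u n) e) e) = (\<Sum>e\<in>G m. scl H (ip H x e) e)"
      using that by (intro sum.cong) (simp_all add: ip_u_G)
    also have "\<dots> = u m"
      by (simp add: u_def p_def)
    also have "(\<Sum>e\<in>G m. (cmod (ip H (u n) e))\<^sup>2) = sum f (G m)"
      unfolding f_def using that by (intro sum.cong) (simp_all add: ip_u_G)
    finally show ?thesis .
  qed
  have u_diff: "(hnorm H (u m - u n))\<^sup>2 < 1 / real (Suc m)" if "m \<le> n" for m n
  proof -
    have "(hnorm H (u n))\<^sup>2 = sum f (G n)"
      using dist_u[of n n] by (simp add: hnorm_def)
    then show ?thesis
      using dist_u[OF that] G_S[of m] le_S[OF G, of n] hnorm_minus_commute[OF u u, of m n] by simp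
  qed
  have inv_lt: "\<exists>M. \<forall>m\<ge>M. 1 / real (Suc m) < e" if e: "e > 0" for e
  proof -
    obtain M where M: "inverse (real (Suc M)) < e"
      using reals_Archimedean[OF e] by blast
    have "1 / real (Suc m) < e" if "m \<ge> M" for m
    proof -
      have "1 / real (Suc m) \<le> inverse (real (Suc M))"
        using that by (simp add: field_simps)
      then show ?thesis
        using M by linarith
    qed
    then show ?thesis
      by blast
  qed
  have "\<exists>y\<in>car H. (\<lambda>m. hnorm H (u m - y)) \<longlonglongrightarrow> 0"
  proof (rule complete)
    fix e :: real
    assume e: "e > 0"
    then obtain M where M: "\<And>m. m \<ge> M \<Longrightarrow> 1 / real (Suc m) < e\<^sup>2"
      using inv_lt[of "e\<^sup>2"] by auto
    have "hnorm H (u m - u l) < e" if "m \<ge> M" "l \<ge> M" for m l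
    proof -
      have "(hnorm H (u m - u l))\<^sup>2 < e\<^sup>2"
        using u_diff[of m l] u_diff[of l m] M[OF that(1)] M[OF that(2)] hnorm_minus_commute[of "u m" "u l"] u
        by (cases "m \<le> l") auto
      then show ?thesis
        using e by (meson less_eq_real_def power_less_imp_less_base)
    qed
    then show "\<exists>M. \<forall>m\<ge>M. \<forall>l\<ge>M. hnorm H (u m - u l) < e"
      by blast
  qed (use u in auto)
  then obtain y where y: "y \<in> car H" and lim: "(\<lambda>m. hnorm H (u m - y)) \<longlonglongrightarrow> 0"
    by blast
  have inv_lim: "(\<lambda>n. 1 / real (Suc n)) \<longlonglongrightarrow> 0"
    using LIMSEQ_inverse_real_of_nat by (simp add: inverse_eq_divide)
  have "ip H (x - y) e = 0" if e: "e \<in> E" for e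
  proof -
    have bound: "cmod (ip H (x - y) e) \<le> sqrt (1 / real (Suc n)) + hnorm H (u n - y)" for n
    proof -
      \<comment> \<open>A basis vector inside \<open>G n\<close> has no coefficient left in
        \<open>x - u n\<close>. One outside can be added to \<open>G n\<close>, and the enlarged sum
        still does not exceed \<open>S\<close>, so its coefficient is at most the gap
        \<open>S - sum f (G n)\<close>.\<close>
      have "(cmod (ip H (x - u n) e))\<^sup>2 \<le> 1 / real (Suc n)"
      proof (cases "e \<in> G n")
        case True
        then show ?thesis
          using e x u sub by (auto simp: ip_diff_left ip_u subset_iff)
      next
        case False
        then have "f e + sum f (G n) \<le> S"
          using le_S[of "insert e (G n)"] G[of n] e by simp
        then have "f e \<le> 1 / real (Suc n)"
          using G_S[of n] by linarith
        then show ?thesis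
          using False e x u sub by (auto simp: ip_diff_left ip_u f_def subset_iff)
      qed
      then have "cmod (ip H (x - u n) e) \<le> sqrt (1 / real (Suc n))"
        by (rule real_le_rsqrt)
      moreover have "cmod (ip H (u n - y) e) \<le> hnorm H (u n - y)"
        using e orth sub u y by (intro cmod_ip_le) auto
      moreover have "ip H (x - y) e = ip H (x - u n) e + ip H (u n - y) e"
        using e x y u sub by (auto simp: ip_diff_left subset_iff)
      then have "cmod (ip H (x - y) e) \<le> cmod (ip H (x - u n) e) + cmod (ip H (u n - y) e)"
        by (simp only: norm_triangle_ineq)
      ultimately show ?thesis
        by linarith
    qed
    have "(\<lambda>n. sqrt (1 / real (Suc n)) + hnorm H (u n - y)) \<longlonglongrightarrow> sqrt 0 + 0"
      by (intro tendsto_intros inv_lim lim)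
    then have "cmod (ip H (x - y) e) \<le> sqrt 0 + 0"
      by (rule LIMSEQ_le_const) (use bound in blast)
    then show ?thesis
      by simp
  qed
  then have "x = y"
    using total[of "x - y"] x y by auto
  have "(\<lambda>n. (hnorm H (u n - y))\<^sup>2) \<longlonglongrightarrow> 0\<^sup>2"
    by (intro tendsto_intros lim)
  \<comment> \<open>Now that \<open>x = y\<close>, these distances tend to 0 while staying above the
    defect in Bessel's inequality, so this defect is 0.\<close>
  moreover have "(hnorm H (u n - y))\<^sup>2 \<ge> (hnorm H x)\<^sup>2 - S" for n
    using dist[of "G n"] G[of n] le_S[of "G n"] hnorm_minus_commute[of x "u n"] u x \<open>x = y\<close>
    by (simp add: u_def)
  ultimately have "(hnorm H x)\<^sup>2 - S \<le> 0\<^sup>2"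
    by (intro LIMSEQ_le_const[where a="(hnorm H x)\<^sup>2 - S"]) blast+
  moreover have "S \<le> (hnorm H x)\<^sup>2"
    by (rule has_sum_le_finite_sums[OF S]) (rule bessel)
  ultimately have "S = (hnorm H x)\<^sup>2"
    by simp
  then show ?thesis
    using S by (simp add: f_def)
qed

text \<open>Polarization over the complex numbers: the quadratic form is real at
  \<open>x + y\<close> and at \<open>x + \<i> y\<close>, which compares the imaginary and the real
  parts of the two mixed terms.\<close>

lemma positive_op_symmetric:
  assumes A: "bounded_op H H A" "positive_op H A" and xy: "x \<in> car H" "y \<in> car H"
  shows "ip H (A x) y = ip H x (A y)"
proof -
  have car: "A z \<in> car H" if "z \<in> car H" for z
    using A that by (auto simp: bounded_op_def)
  have add: "A (w + z) = A w + A z" if "w \<in> car H" "z \<in> car H" for w z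
    using A that by (auto simp: bounded_op_def)
  have scl: "A (scl H a z) = scl H a (A z)" if "z \<in> car H" for a z
    using A that by (auto simp: bounded_op_def)
  have real: "Im (ip H (A z) z) = 0" if "z \<in> car H" for z
    using A that by (auto simp: positive_op_def complex_nonneg_Reals_iff)
  have "Im (ip H (A x) y) + Im (ip H (A y) x) = 0"
    using real[of "x + y"] real[of x] real[of y] xy car by (simp add: add ip_add_left ip_add_right)
  moreover have "Re (ip H (A y) x) - Re (ip H (A x) y) = 0"
    using real[of "x + scl H \<i> y"] real[of x] real[of y] xy car
    by (simp add: add scl ip_add_left ip_add_right ip_scl_left ip_scl_right)
  moreover have "ip H x (A y) = cnj (ip H (A y) x)"
    using xy car by (intro ip_commute) auto
  ultimately show ?thesis
    by (simp add: complex_eq_iff)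
qed

text \<open>\<open>op_sqrt\<close> picks some positive root \<open>B\<close>, so every such root
  must be shown to agree with \<open>P\<close>. It is compared with \<open>P\<close> separately on
  the range and on the kernel of \<open>P\<close>.\<close>

lemma op_sqrt_idempotent:
  assumes P: "bounded_op H H P" "positive_op H P"
    and idem: "\<And>x. x \<in> car H \<Longrightarrow> P (P x) = P x" and x: "x \<in> car H"
  shows "op_sqrt H P x = P x"
proof -
  define B where "B = op_sqrt H P"
  have "bounded_op H H B \<and> positive_op H B \<and> (\<forall>x\<in>car H. B (B x) = P x)"
    unfolding B_def op_sqrt_def by (rule someI[where x = P]) (use P idem in blast)
  then have B: "bounded_op H H B" "positive_op H B" and sq: "\<And>x. x \<in> car H \<Longrightarrow> B (B x) = P x"
    by auto
  have car: "B z \<in> car H" "P z \<in> car H" if "z \<in> car H" for z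
    using B P that by (auto simp: bounded_op_def)
  have add: "B (w + z) = B w + B z" if "w \<in> car H" "z \<in> car H" for w z
    using B that by (auto simp: bounded_op_def)
  have diff: "B (w - z) = B w - B z" if "w \<in> car H" "z \<in> car H" for w z
    using add[of "w - z" z] that by simp
  have P_add: "P (w + z) = P w + P z" if "w \<in> car H" "z \<in> car H" for w z
    using P that by (auto simp: bounded_op_def)
  have P_diff: "P (w - z) = P w - P z" if "w \<in> car H" "z \<in> car H" for w z
    using P_add[of "w - z" z] that by simp
  \<comment> \<open>On the range of \<open>P\<close> we have \<open>(B + 1)(B - 1) = 0\<close>, and \<open>B + 1\<close> is injective since \<open>B \<ge> 0\<close>.\<close>
  define y where "y = B (P x) - P x"
  have y: "y \<in> car H"
    using x car by (auto simp: y_def)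
  have "B y = - y"
    using x car by (simp add: y_def diff sq idem)
  then have "ip H (B y) y = - ip H y y"
    using ip_diff_left[of 0 y y] y by simp
  then have "Re (ip H y y) \<le> 0"
    using B y by (auto simp: positive_op_def complex_nonneg_Reals_iff dest!: bspec[of _ _ y])
  then have "hnorm H y = 0"
    using y by (simp add: ip_self)
  then have 1: "B (P x) = P x"
    using hnorm_eq_0[OF y] by (simp add: y_def)
  \<comment> \<open>The kernel part: symmetry of \<open>B\<close> turns the squared norm of
    \<open>B z\<close> into the inner product of \<open>B (B z) = P z = 0\<close> with
    \<open>z\<close>.\<close>
  define z where "z = x - P x"
  have z: "z \<in> car H"
    using x car by (auto simp: z_def)
  have "ip H (B z) (B z) = ip H (B (B z)) z"
    using positive_op_symmetric[OF B, of "B z" z] z car by simp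
  also have "B (B z) = 0"
    using x car z by (simp add: sq z_def P_diff idem)
  finally have "B z = 0"
    using ip_definite z car by simp
  have "B x = B (P x + z)"
    by (simp add: z_def)
  also have "\<dots> = P x"
    using add[of "P x" z] 1 \<open>B z = 0\<close> x car(2) z by auto
  finally show ?thesis
    by (simp add: B_def)
qed

end

section \<open>Square-summable sequences\<close>

abbreviation l2 :: "'i set \<Rightarrow> ('i \<Rightarrow> complex) hilb" where
  "l2 I \<equiv> ell2 I complex_hilb"

lemma hnorm_complex_hilb [simp]: "hnorm complex_hilb z = cmod z"
proof -
  have "Re (z * cnj z) = (cmod z)\<^sup>2"
    by (metis Re_complex_of_real complex_norm_square)
  then show ?thesis
    by (simp only: hnorm_def complex_hilb_def hilb.simps real_sqrt_abs abs_norm_cancel)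
qed

lemma car_l2: "car (l2 I) = {f. (\<forall>i. i \<notin> I \<longrightarrow> f i = 0) \<and> (\<lambda>i. (cmod (f i))\<^sup>2) summable_on I}"
  by (simp add: ell2_def) (simp add: complex_hilb_def)

lemma l2_zero_outside: "f \<in> car (l2 I) \<Longrightarrow> i \<notin> I \<Longrightarrow> f i = 0"
  by (simp add: car_l2)

lemma l2_summable: "f \<in> car (l2 I) \<Longrightarrow> (\<lambda>i. (cmod (f i))\<^sup>2) summable_on I"
  by (simp add: car_l2)

lemma scl_l2 [simp]: "scl (l2 I) a f = (\<lambda>i. a * f i)"
  by (simp add: ell2_def complex_hilb_def)

lemma ip_l2: "ip (l2 I) f g = (\<Sum>\<^sub>\<infinity>i\<in>I. f i * cnj (g i))"
  by (simp add: ell2_def complex_hilb_def)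

lemma l2_abs_summable_mult:
  assumes "f \<in> car (l2 I)" "g \<in> car (l2 I)"
  shows "(\<lambda>i. norm (f i * cnj (g i))) summable_on I"
proof (rule Infinite_Sum.abs_summable_on_comparison_test')
  show "(\<lambda>i. (cmod (f i))\<^sup>2 + (cmod (g i))\<^sup>2) summable_on I"
    using assms by (intro summable_on_add l2_summable)
  fix i
  have "2 * (cmod (f i) * cmod (g i)) \<le> (cmod (f i))\<^sup>2 + (cmod (g i))\<^sup>2"
    using sum_squares_bound[of "cmod (f i)" "cmod (g i)"] by simp
  moreover have "0 \<le> cmod (f i) * cmod (g i)"
    by simp
  ultimately have "cmod (f i) * cmod (g i) \<le> (cmod (f i))\<^sup>2 + (cmod (g i))\<^sup>2"
    by linarith
  then show "norm (f i * cnj (g i)) \<le> (cmod (f i))\<^sup>2 + (cmod (g i))\<^sup>2"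
    by (simp add: norm_mult)
qed

lemma l2_ip_has_sum:
  assumes "f \<in> car (l2 I)" "g \<in> car (l2 I)"
  shows "((\<lambda>i. f i * cnj (g i)) has_sum ip (l2 I) f g) I"
  unfolding ip_l2 by (rule has_sum_infsum[OF abs_summable_summable[OF l2_abs_summable_mult[OF assms]]])

lemma ip_l2_eqI:
  assumes "((\<lambda>i. f i * cnj (g i)) has_sum c) I"
  shows "ip (l2 I) f g = c"
  unfolding ip_l2 using assms by (rule infsumI)

lemma infsum_complex_of_real:
  "(\<Sum>\<^sub>\<infinity>i\<in>I. complex_of_real (f i)) = complex_of_real (\<Sum>\<^sub>\<infinity>i\<in>I. f i)"
proof (cases "f summable_on I")
  case True
  then show ?thesis
    by (intro infsumI has_sum_of_real has_sum_infsum)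
next
  case False
  moreover have "\<not> (\<lambda>i. complex_of_real (f i)) summable_on I"
    using False summable_on_Re[of "\<lambda>i. complex_of_real (f i)" I] by auto
  ultimately show ?thesis
    by (simp add: infsum_not_exists)
qed

lemma l2_ip_self: "ip (l2 I) f f = complex_of_real (\<Sum>\<^sub>\<infinity>i\<in>I. (cmod (f i))\<^sup>2)"
  unfolding ip_l2 complex_norm_square[symmetric] infsum_complex_of_real ..

lemma l2_hnorm: "hnorm (l2 I) f = sqrt (\<Sum>\<^sub>\<infinity>i\<in>I. (cmod (f i))\<^sup>2)"
  by (simp add: hnorm_def l2_ip_self)

lemma l2_hnorm_nonneg [simp]: "0 \<le> hnorm (l2 I) f"
  by (simp add: l2_hnorm infsum_nonneg)

lemma l2_norm_has_sum:
  assumes "f \<in> car (l2 I)"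
  shows "((\<lambda>i. (cmod (f i))\<^sup>2) has_sum (hnorm (l2 I) f)\<^sup>2) I"
  using l2_summable[OF assms] by (simp add: l2_hnorm infsum_nonneg)

lemma l2_sum_le_norm:
  assumes "f \<in> car (l2 I)" "finite F" "F \<subseteq> I"
  shows "(\<Sum>i\<in>F. (cmod (f i))\<^sup>2) \<le> (hnorm (l2 I) f)\<^sup>2"
  using finite_sum_le_has_sum[OF l2_norm_has_sum[OF assms(1)]] assms by simp

lemma l2_cmod_le_hnorm:
  assumes "f \<in> car (l2 I)"
  shows "cmod (f i) \<le> hnorm (l2 I) f"
proof (cases "i \<in> I")
  case True
  then show ?thesis
    using l2_sum_le_norm[OF assms, of "{i}"] by (auto intro: power2_le_imp_le[of "cmod (f i)"])
qed (simp add: l2_zero_outside[OF assms])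

text \<open>A nonnegative family with bounded finite sums is summable, so membership and the norm
  bound come together. Operators that move coordinates injectively can therefore be estimated on
  finite index sets alone.\<close>

lemma l2I:
  assumes "\<And>i. i \<notin> I \<Longrightarrow> f i = 0"
    and "\<And>F. finite F \<Longrightarrow> F \<subseteq> I \<Longrightarrow> (\<Sum>i\<in>F. (cmod (f i))\<^sup>2) \<le> b\<^sup>2" and "0 \<le> b"
  shows "f \<in> car (l2 I)" "hnorm (l2 I) f \<le> b"
proof -
  have "(\<lambda>i. (cmod (f i))\<^sup>2) summable_on I"
    using assms(2) by (intro nonneg_bdd_above_summable_on) (auto intro!: bdd_aboveI2)
  then show f: "f \<in> car (l2 I)"
    using assms(1) by (simp add: car_l2)
  have "(hnorm (l2 I) f)\<^sup>2 \<le> b\<^sup>2"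
    by (rule has_sum_le_finite_sums[OF l2_norm_has_sum[OF f]]) (rule assms(2))
  then show "hnorm (l2 I) f \<le> b"
    using assms(3) by (rule power2_le_imp_le)
qed

lemma l2_dominated:
  assumes "g \<in> car (l2 I)" "\<And>i. i \<notin> I \<Longrightarrow> f i = 0" "\<And>i. i \<in> I \<Longrightarrow> cmod (f i) \<le> cmod (g i)"
  shows "f \<in> car (l2 I)"
  using assms by (auto simp: car_l2 intro: summable_on_comparison_test)

lemma l2_add:
  assumes "f \<in> car (l2 I)" "g \<in> car (l2 I)"
  shows "f + g \<in> car (l2 I)"
proof -
  have "(\<lambda>i. (cmod (f i + g i))\<^sup>2) summable_on I"
  proof (rule summable_on_comparison_test)
    show "(\<lambda>i. 2 * (cmod (f i))\<^sup>2 + 2 * (cmod (g i))\<^sup>2) summable_on I"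
      using assms by (intro summable_on_add summable_on_cmult_right l2_summable)
    fix i
    have "(cmod (f i + g i))\<^sup>2 \<le> (cmod (f i) + cmod (g i))\<^sup>2"
      by (intro power_mono norm_triangle_ineq) simp
    also have "\<dots> \<le> 2 * (cmod (f i))\<^sup>2 + 2 * (cmod (g i))\<^sup>2"
      using sum_squares_bound[of "cmod (f i)" "cmod (g i)"] by (simp add: power2_sum)
    finally show "(cmod (f i + g i))\<^sup>2 \<le> 2 * (cmod (f i))\<^sup>2 + 2 * (cmod (g i))\<^sup>2" .
  qed simp
  then show ?thesis
    using assms by (simp add: car_l2)
qed

lemma l2_scl:
  assumes "f \<in> car (l2 I)"
  shows "(\<lambda>i. a * f i) \<in> car (l2 I)"
  using assms by (auto simp: car_l2 norm_mult power_mult_distrib intro: summable_on_cmult_right)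

lemma vector_space_l2: "vector_space (scl (l2 I))"
  by unfold_locales (auto simp: algebra_simps fun_eq_iff)

lemma l2_subspace: "module.subspace (scl (l2 I)) (car (l2 I))"
proof -
  interpret vector_space "scl (l2 I)"
    by (rule vector_space_l2)
  show ?thesis
  proof (rule subspaceI)
    show "0 \<in> car (l2 I)"
      by (simp add: car_l2)
  qed (simp_all add: l2_add l2_scl)
qed

lemma l2_diff:
  assumes "f \<in> car (l2 I)" "g \<in> car (l2 I)"
  shows "f - g \<in> car (l2 I)"
proof -
  interpret vector_space "scl (l2 I)"
    by (rule vector_space_l2)
  show ?thesis
    using l2_subspace assms by (rule subspace_diff)
qed

text \<open>Coordinates are dominated by the norm, hence converge. On each finite index set the
  Cauchy estimate survives the limit in \<open>l\<close>, and \<open>l2I\<close> assembles these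
  bounds into a norm bound for \<open>u m - x\<close>; that \<open>x\<close> lies in the space
  follows from the same statement.\<close>

lemma l2_complete:
  fixes u :: "nat \<Rightarrow> 'i \<Rightarrow> complex"
  assumes u: "\<And>m. u m \<in> car (l2 I)"
    and cauchy: "\<And>e. e > 0 \<Longrightarrow> \<exists>M. \<forall>m\<ge>M. \<forall>l\<ge>M. hnorm (l2 I) (u m - u l) < e"
  shows "\<exists>x\<in>car (l2 I). (\<lambda>m. hnorm (l2 I) (u m - x)) \<longlonglongrightarrow> 0"
proof -
  have u_diff: "u m - u l \<in> car (l2 I)" for m l
    by (rule l2_diff[OF u u])
  have "Cauchy (\<lambda>m. u m i)" for i
  proof (rule metric_CauchyI)
    fix e :: real
    assume "e > 0"
    then obtain M where M: "\<And>m l. m \<ge> M \<Longrightarrow> l \<ge> M \<Longrightarrow> hnorm (l2 I) (u m - u l) < e"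
      using cauchy by blast
    have "dist (u m i) (u l i) < e" if "m \<ge> M" "l \<ge> M" for m l
      using l2_cmod_le_hnorm[OF u_diff, of m l i] M[OF that] by (simp add: dist_norm)
    then show "\<exists>M. \<forall>m\<ge>M. \<forall>n\<ge>M. dist (u m i) (u n i) < e"
      by blast
  qed
  then have "\<forall>i. \<exists>l. (\<lambda>m. u m i) \<longlonglongrightarrow> l"
    by (simp add: Cauchy_convergent_iff convergent_def)
  from choice[OF this] obtain x where x: "\<And>i. (\<lambda>m. u m i) \<longlonglongrightarrow> x i"
    by blast
  have x_outside: "x i = 0" if "i \<notin> I" for i
    using x[of i] l2_zero_outside[OF u that] by (simp add: LIMSEQ_const_iff)
  have bound: "\<exists>M. \<forall>m\<ge>M. u m - x \<in> car (l2 I) \<and> hnorm (l2 I) (u m - x) \<le> e" if "e > 0" for e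
  proof -
    obtain M where M: "\<And>m l. m \<ge> M \<Longrightarrow> l \<ge> M \<Longrightarrow> hnorm (l2 I) (u m - u l) < e"
      using cauchy \<open>e > 0\<close> by blast
    have le: "(\<Sum>i\<in>F. (cmod ((u m - x) i))\<^sup>2) \<le> e\<^sup>2" if "m \<ge> M" "finite F" "F \<subseteq> I" for m F
    proof (rule LIMSEQ_le_const2)
      show "(\<lambda>l. \<Sum>i\<in>F. (cmod ((u m - u l) i))\<^sup>2) \<longlonglongrightarrow> (\<Sum>i\<in>F. (cmod ((u m - x) i))\<^sup>2)"
        by (auto intro!: tendsto_intros x)
      have "(\<Sum>i\<in>F. (cmod ((u m - u l) i))\<^sup>2) \<le> e\<^sup>2" if "l \<ge> M" for l
        using l2_sum_le_norm[OF u_diff[of m l] \<open>finite F\<close> \<open>F \<subseteq> I\<close>] M[OF \<open>m \<ge> M\<close> that]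
        by (smt (verit) l2_hnorm_nonneg power_mono)
      then show "\<exists>N. \<forall>l\<ge>N. (\<Sum>i\<in>F. (cmod ((u m - u l) i))\<^sup>2) \<le> e\<^sup>2"
        by blast
    qed
    have "u m - x \<in> car (l2 I) \<and> hnorm (l2 I) (u m - x) \<le> e" if "m \<ge> M" for m
    proof -
      have "(u m - x) i = 0" if "i \<notin> I" for i
        using l2_zero_outside[OF u that] x_outside[OF that] by simp
      then show ?thesis
        using that \<open>e > 0\<close> le by (auto intro!: l2I[of I "u m - x" e])
    qed
    then show ?thesis
      by blast
  qed
  obtain M where "u M - x \<in> car (l2 I)"
    using bound[of 1] by auto
  then have "u M - (u M - x) \<in> car (l2 I)"
    by (rule l2_diff[OF u])
  then have "x \<in> car (l2 I)"
    by simp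
  moreover have "(\<lambda>m. hnorm (l2 I) (u m - x)) \<longlonglongrightarrow> 0"
  proof (rule LIMSEQ_I)
    fix r :: real
    assume "r > 0"
    then obtain M where "\<And>m. m \<ge> M \<Longrightarrow> hnorm (l2 I) (u m - x) \<le> r / 2"
      using bound[of "r / 2"] by auto
    then show "\<exists>M. \<forall>m\<ge>M. norm (hnorm (l2 I) (u m - x) - 0) < r"
      using \<open>r > 0\<close> by (intro exI[of _ M]) (force simp: abs_of_nonneg)
  qed
  ultimately show ?thesis
    by blast
qed

lemma hilbert_space_l2: "hilbert_space (l2 I)"
proof -
  interpret vector_space "scl (l2 I)"
    by (rule vector_space_l2)
  show ?thesis
  proof
    show "subspace (car (l2 I))"
      by (rule l2_subspace)
  next
    fix x y :: "'a \<Rightarrow> complex"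
    show "ip (l2 I) x y = cnj (ip (l2 I) y x)"
      by (simp add: ip_l2 mult.commute flip: infsum_cnj)
  next
    fix x y z :: "'a \<Rightarrow> complex"
    assume "x \<in> car (l2 I)" "y \<in> car (l2 I)" "z \<in> car (l2 I)"
    then have "((\<lambda>i. x i * cnj (z i) + y i * cnj (z i)) has_sum ip (l2 I) x z + ip (l2 I) y z) I"
      by (intro has_sum_add l2_ip_has_sum)
    then show "ip (l2 I) (x + y) z = ip (l2 I) x z + ip (l2 I) y z"
      by (intro ip_l2_eqI) (simp add: algebra_simps)
  next
    fix x y :: "'a \<Rightarrow> complex" and a
    show "ip (l2 I) (scl (l2 I) a x) y = a * ip (l2 I) x y"
      by (simp add: ip_l2 mult.assoc infsum_cmult_right')
  next
    fix x :: "'a \<Rightarrow> complex"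
    show "ip (l2 I) x x \<in> \<real>\<^sub>\<ge>\<^sub>0"
      by (simp add: l2_ip_self infsum_nonneg)
  next
    fix x :: "'a \<Rightarrow> complex"
    assume x: "x \<in> car (l2 I)" "ip (l2 I) x x = 0"
    then have "hnorm (l2 I) x = 0"
      by (simp add: hnorm_def)
    then show "x = 0"
      using l2_cmod_le_hnorm[OF x(1)] by (auto simp: fun_eq_iff)
  qed (rule l2_complete)
qed

section \<open>The standard basis: traces, adjoints and coordinate subspaces\<close>

lemma fock_basis_in_l2:
  fixes I :: "nat list list set"
  shows "\<beta> \<in> I \<Longrightarrow> fock_basis \<beta> \<in> car (l2 I)"
  by (rule l2I(1)[where b = 1]) (auto simp: fock_basis_def if_distrib[of cmod] if_distrib[of "\<lambda>x. x ^ 2"] sum.delta cong: if_cong)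

lemma ip_fock_basis:
  assumes "\<beta> \<in> I"
  shows "ip (l2 I) f (fock_basis \<beta>) = f \<beta>"
proof (rule ip_l2_eqI)
  show "((\<lambda>i. f i * cnj (fock_basis \<beta> i)) has_sum f \<beta>) I"
    by (rule has_sum_finite_neutralI[of "{\<beta>}"]) (use assms in \<open>auto simp: fock_basis_def\<close>)
qed

lemma ip_fock_basis_left:
  assumes "\<beta> \<in> I"
  shows "ip (l2 I) (fock_basis \<beta>) f = cnj (f \<beta>)"
proof (rule ip_l2_eqI)
  show "((\<lambda>i. fock_basis \<beta> i * cnj (f i)) has_sum cnj (f \<beta>)) I"
    by (rule has_sum_finite_neutralI[of "{\<beta>}"]) (use assms in \<open>auto simp: fock_basis_def\<close>)
qed

lemma onb_fock_basis: "onb (l2 I) (fock_basis ` I)"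
  unfolding onb_def
proof (intro conjI ballI impI)
  fix x
  assume "x \<in> car (l2 I)" "\<forall>e\<in>fock_basis ` I. ip (l2 I) x e = 0"
  then have "x i = 0" for i
    by (cases "i \<in> I") (auto simp: ip_fock_basis l2_zero_outside)
  then show "x = 0"
    by (simp add: fun_eq_iff)
qed (auto simp: ip_fock_basis fock_basis_in_l2, auto simp: fock_basis_def fun_eq_iff split: if_splits)

lemma has_sum_finite_sum:
  fixes f :: "'i \<Rightarrow> 'e \<Rightarrow> 'b::topological_comm_monoid_add"
  assumes "finite F" "\<And>i. i \<in> F \<Longrightarrow> (f i has_sum s i) E"
  shows "((\<lambda>e. \<Sum>i\<in>F. f i e) has_sum (\<Sum>i\<in>F. s i)) E"
  using assms by (induction F rule: finite_induct) (auto intro: has_sum_add)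

text \<open>For an arbitrary basis \<open>E\<close>, the diagonal term at \<open>e\<close> is the
  sum over \<open>\<beta> \<in> F\<close> of the squared moduli of the coefficients of
  \<open>fock_basis \<beta>\<close> at \<open>e\<close>. Since \<open>F\<close> is finite, the two
  sums may be exchanged, and Parseval makes each \<open>\<beta>\<close> contribute 1. The standard
  basis is then the witness that no other value qualifies as the trace.\<close>

lemma op_trace_coordinate_proj:
  fixes I :: "nat list list set"
  assumes F: "finite F" "F \<subseteq> I"
    and A: "\<And>f. f \<in> car (l2 I) \<Longrightarrow> A f = (\<lambda>\<beta>. if \<beta> \<in> F then f \<beta> else 0)"
  shows "op_trace (l2 I) A = of_nat (card F)"
proof -
  interpret hilbert_space "l2 I"
    by (rule hilbert_space_l2)
  have sum: "((\<lambda>e. ip (l2 I) (A e) e) has_sum of_nat (card F)) E" if E: "onb (l2 I) E" for E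
  proof -
    have diag: "ip (l2 I) (A e) e = of_real (\<Sum>\<beta>\<in>F. (cmod (ip (l2 I) (fock_basis \<beta>) e))\<^sup>2)" if "e \<in> E" for e
    proof (rule ip_l2_eqI)
      have e: "e \<in> car (l2 I)"
        using E that by (auto simp: onb_def)
      have "of_real (\<Sum>\<beta>\<in>F. (cmod (ip (l2 I) (fock_basis \<beta>) e))\<^sup>2) = (\<Sum>\<beta>\<in>F. e \<beta> * cnj (e \<beta>))"
        using F unfolding of_real_sum
        by (intro sum.cong) (auto simp: ip_fock_basis_left subset_iff complex_norm_square simp del: of_real_power)
      then show "((\<lambda>i. A e i * cnj (e i)) has_sum of_real (\<Sum>\<beta>\<in>F. (cmod (ip (l2 I) (fock_basis \<beta>) e))\<^sup>2)) I"
        using F by (intro has_sum_finite_neutralI[of F]) (auto simp: A[OF e])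
    qed
    have "hnorm (l2 I) (fock_basis \<beta>) = 1" if "\<beta> \<in> I" for \<beta>
      using ip_fock_basis[OF that, of "fock_basis \<beta>"] by (simp add: hnorm_def fock_basis_def)
    then have "((\<lambda>e. (cmod (ip (l2 I) (fock_basis \<beta>) e))\<^sup>2) has_sum 1) E" if "\<beta> \<in> F" for \<beta>
      using Parseval[OF E fock_basis_in_l2] that F by (metis one_power2 subsetD)
    then have "((\<lambda>e. \<Sum>\<beta>\<in>F. (cmod (ip (l2 I) (fock_basis \<beta>) e))\<^sup>2) has_sum (\<Sum>\<beta>\<in>F. 1)) E"
      by (rule has_sum_finite_sum[OF F(1)])
    then have "((\<lambda>e. \<Sum>\<beta>\<in>F. (cmod (ip (l2 I) (fock_basis \<beta>) e))\<^sup>2) has_sum real (card F)) E"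
      by simp
    then have "((\<lambda>e. complex_of_real (\<Sum>\<beta>\<in>F. (cmod (ip (l2 I) (fock_basis \<beta>) e))\<^sup>2)) has_sum of_real (real (card F))) E"
      by (rule has_sum_of_real)
    then show ?thesis
      by (subst has_sum_cong[OF diag]) auto
  qed
  show ?thesis
    unfolding op_trace_def
  proof (rule the_equality)
    fix c
    assume "\<forall>E. onb (l2 I) E \<longrightarrow> ((\<lambda>e. ip (l2 I) (A e) e) has_sum c) E"
    then show "c = of_nat (card F)"
      using sum onb_fock_basis has_sum_unique by blast
  qed (use sum in blast)
qed

text \<open>Testing against the basis vectors determines every coordinate of the adjoint vector. The
  target \<open>K\<close> is arbitrary, so that the Berezin kernel with its
  \<open>defect_space\<close> coefficients is covered as well as operators on
  \<open>l2 I\<close>.\<close>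

lemma adj_l2_eqI:
  fixes I :: "nat list list set"
  assumes "x \<in> car (l2 I)" "\<And>z. z \<in> car (l2 I) \<Longrightarrow> ip K (A z) y = ip (l2 I) z x"
  shows "adj (l2 I) K A y = x"
  unfolding adj_def
proof (rule the_equality)
  fix x'
  assume x': "x' \<in> car (l2 I) \<and> (\<forall>z\<in>car (l2 I). ip K (A z) y = ip (l2 I) z x')"
  have "x' \<beta> = x \<beta>" for \<beta>
  proof (cases "\<beta> \<in> I")
    case True
    then have "ip (l2 I) (fock_basis \<beta>) x' = ip (l2 I) (fock_basis \<beta>) x"
      using x' assms fock_basis_in_l2[OF True] by metis
    then show ?thesis
      using True by (simp add: ip_fock_basis_left)
  qed (use x' assms l2_zero_outside in metis)
  then show "x' = x"
    by blast
qed (use assms in blast)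

lemma l2_mono:
  assumes "J \<subseteq> I"
  shows "car (l2 J) = {f \<in> car (l2 I). \<forall>i. i \<notin> J \<longrightarrow> f i = 0}"
proof -
  have "(\<lambda>i. (cmod (f i))\<^sup>2) summable_on J \<longleftrightarrow> (\<lambda>i. (cmod (f i))\<^sup>2) summable_on I"
    if "\<And>i. i \<notin> J \<Longrightarrow> f i = 0" for f :: "'a \<Rightarrow> complex"
    using that assms by (intro summable_on_cong_neutral) auto
  then show ?thesis
    using assms by (auto simp: car_l2)
qed

text \<open>Evaluation at a coordinate is dominated by the norm, so vanishing outside
  \<open>J\<close> passes to the closure.\<close>

lemma closed_subspace_l2:
  assumes "J \<subseteq> I"
  shows "closed_subspace (l2 I) (car (l2 J))"
proof -
  interpret hilbert_space "l2 I"
    by (rule hilbert_space_l2)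
  have "hclosure (l2 I) (car (l2 J)) \<subseteq> car (l2 J)"
  proof
    fix f
    assume f: "f \<in> hclosure (l2 I) (car (l2 J))"
    then have f_car: "f \<in> car (l2 I)"
      by (simp add: hclosure_def)
    have "f i = 0" if "i \<notin> J" for i
    proof (rule ccontr)
      assume "f i \<noteq> 0"
      then have "cmod (f i) > 0"
        by simp
      then obtain g where g: "g \<in> car (l2 J)" "hnorm (l2 I) (f - g) < cmod (f i)"
        using f unfolding hclosure_def by blast
      then have "cmod (f i - g i) < cmod (f i)"
        using l2_cmod_le_hnorm[of "f - g" I i] f_car l2_mono[OF assms] by auto
      then show False
        using l2_zero_outside[OF g(1) that] by simp
    qed
    then show "f \<in> car (l2 J)"
      using f_car l2_mono[OF assms] by auto
  qed
  moreover have "hnorm (l2 I) 0 = 0"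
    by (simp add: l2_hnorm)
  then have "car (l2 J) \<subseteq> hclosure (l2 I) (car (l2 J))"
    using l2_mono[OF assms] by (force simp: hclosure_def)
  moreover have "subspace (car (l2 J))"
    using l2_subspace[of J] by (simp add: ell2_def)
  ultimately show ?thesis
    using l2_mono[OF assms] by (auto simp: closed_subspace_def)
qed

lemma ortho_proj_l2:
  fixes I :: "nat list list set"
  assumes "J \<subseteq> I" and f: "f \<in> car (l2 I)"
  shows "ortho_proj (l2 I) (car (l2 J)) f = (\<lambda>i. if i \<in> J then f i else 0)"
  unfolding ortho_proj_def
proof (rule the_equality)
  let ?g = "\<lambda>i. if i \<in> J then f i else 0"
  have "?g \<in> car (l2 I)"
    using f by (rule l2_dominated) (use assms in auto)
  then show "?g \<in> car (l2 J) \<and> (\<forall>z\<in>car (l2 J). ip (l2 I) (f - ?g) z = 0)"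
    using l2_mono[OF assms(1)] l2_zero_outside by (auto simp: ip_l2 intro!: infsum_0)
  fix y
  assume y: "y \<in> car (l2 J) \<and> (\<forall>z\<in>car (l2 J). ip (l2 I) (f - y) z = 0)"
  show "y = ?g"
  proof
    fix i
    show "y i = ?g i"
    proof (cases "i \<in> J")
      case True
      then have "ip (l2 I) (f - y) (fock_basis i) = 0"
        using y fock_basis_in_l2 by blast
      then show ?thesis
        using True assms by (simp add: ip_fock_basis subset_iff)
    qed (use y l2_zero_outside in auto)
  qed
qed

section \<open>Compressed shifts\<close>

definition prepend :: "nat \<Rightarrow> 'a list \<Rightarrow> 'a list list \<Rightarrow> 'a list list" where
  "prepend i \<alpha> \<beta> = \<beta>[i := \<alpha> @ \<beta> ! i]"

text \<open>The letters are dropped unseen, so this inverts \<open>prepend i \<alpha>\<close> only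
  on tuples whose slot \<open>i\<close> begins with \<open>\<alpha>\<close>;
  \<open>prepend_strip\<close> carries that condition.\<close>

definition strip :: "nat \<Rightarrow> nat \<Rightarrow> 'a list list \<Rightarrow> 'a list list" where
  "strip i m \<beta> = \<beta>[i := drop m (\<beta> ! i)]"

lemma length_prepend [simp]: "length (prepend i \<alpha> \<beta>) = length \<beta>"
  by (simp add: prepend_def)

lemma length_strip [simp]: "length (strip i m \<beta>) = length \<beta>"
  by (simp add: strip_def)

lemma nth_prepend: "i < length \<beta> \<Longrightarrow> prepend i \<alpha> \<beta> ! l = (if l = i then \<alpha> @ \<beta> ! i else \<beta> ! l)"
  by (simp add: prepend_def nth_list_update)

lemma nth_strip: "i < length \<beta> \<Longrightarrow> strip i m \<beta> ! l = (if l = i then drop m (\<beta> ! i) else \<beta> ! l)"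
  by (simp add: strip_def nth_list_update)

lemma strip_prepend: "i < length \<beta> \<Longrightarrow> strip i (length \<alpha>) (prepend i \<alpha> \<beta>) = \<beta>"
  by (simp add: prepend_def strip_def)

lemma prepend_strip:
  assumes "i < length \<beta>" "take (length \<alpha>) (\<beta> ! i) = \<alpha>"
  shows "prepend i \<alpha> (strip i (length \<alpha>) \<beta>) = \<beta>"
  using assms append_take_drop_id[of "length \<alpha>" "\<beta> ! i"] by (simp add: prepend_def strip_def)

text \<open>Coordinate projections. Starting from the identity, \<open>cp_map\<close> and
  \<open>id_minus_cp\<close> produce only operators of this kind below, so identities between
  operators become identities between sets of indices.\<close>

abbreviation restrict_to :: "'i set \<Rightarrow> ('i \<Rightarrow> complex) \<Rightarrow> 'i \<Rightarrow> complex" where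
  "restrict_to S f \<equiv> (\<lambda>\<beta>. if \<beta> \<in> S then f \<beta> else 0)"

lemma restrict_to_in_l2: "f \<in> car (l2 I) \<Longrightarrow> restrict_to S f \<in> car (l2 I)"
  by (rule l2_dominated) (auto simp: l2_zero_outside)

lemma positive_restrict_to:
  assumes "\<And>f. f \<in> car (l2 I) \<Longrightarrow> A f = restrict_to S f"
  shows "positive_op (l2 I) A"
  unfolding positive_op_def
proof
  fix f
  assume f: "f \<in> car (l2 I)"
  have "(restrict_to S f) i * cnj (f i) = complex_of_real (if i \<in> S then (cmod (f i))\<^sup>2 else 0)" for i
    by (simp add: complex_norm_square del: of_real_power)
  then have "ip (l2 I) (A f) f = complex_of_real (\<Sum>\<^sub>\<infinity>i\<in>I. if i \<in> S then (cmod (f i))\<^sup>2 else 0)"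
    unfolding assms[OF f] ip_l2 by (simp only: infsum_complex_of_real)
  then show "ip (l2 I) (A f) f \<in> \<real>\<^sub>\<ge>\<^sub>0"
    by (simp add: infsum_nonneg)
qed

lemma bounded_restrict_to:
  assumes "\<And>f. f \<in> car (l2 I) \<Longrightarrow> A f = restrict_to S f"
  shows "bounded_op (l2 I) (l2 I) A"
  unfolding bounded_op_def
proof (intro conjI ballI allI exI)
  fix f
  assume f: "f \<in> car (l2 I)"
  then show "A f \<in> car (l2 I)"
    by (simp add: assms restrict_to_in_l2)
  show "A (scl (l2 I) a f) = scl (l2 I) a (A f)" for a
    using f l2_scl[OF f, of a] by (auto simp: assms)
  show "A (f + g) = A f + A g" if "g \<in> car (l2 I)" for g
    using f that l2_add[OF f that] by (auto simp: assms)
  have "(\<Sum>i\<in>F. (cmod (restrict_to S f i))\<^sup>2) \<le> (hnorm (l2 I) f)\<^sup>2" if "finite F" "F \<subseteq> I" for F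
  proof -
    have "(\<Sum>i\<in>F. (cmod (restrict_to S f i))\<^sup>2) \<le> (\<Sum>i\<in>F. (cmod (f i))\<^sup>2)"
      by (intro sum_mono) auto
    then show ?thesis
      using l2_sum_le_norm[OF f that] by linarith
  qed
  then show "hnorm (l2 I) (A f) \<le> 1 * hnorm (l2 I) f"
    unfolding assms[OF f] using f by (simp, intro l2I(2)) (auto simp: l2_zero_outside)
qed

text \<open>A finite set \<open>F\<close> carries all of the absolute sum except less than
  \<open>r\<close>. Once \<open>q\<close> exceeds the largest value of \<open>L\<close> on
  \<open>F\<close>, no term of \<open>F\<close> is left. If \<open>F\<close> is empty, the value of
  \<open>Max\<close> is irrelevant.\<close>

lemma infsum_tail_tendsto_0:
  fixes g :: "'i \<Rightarrow> complex" and L :: "'i \<Rightarrow> nat"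
  assumes "(\<lambda>i. norm (g i)) summable_on I"
  shows "(\<lambda>q. \<Sum>\<^sub>\<infinity>i\<in>I. if q \<le> L i then g i else 0) \<longlonglongrightarrow> 0"
proof (rule LIMSEQ_I)
  fix r :: real
  assume "r > 0"
  define S where "S = (\<Sum>\<^sub>\<infinity>i\<in>I. norm (g i))"
  have S: "((\<lambda>i. norm (g i)) has_sum S) I"
    unfolding S_def using assms by (rule has_sum_infsum)
  then obtain F where F: "finite F" "F \<subseteq> I" "S - r < (\<Sum>i\<in>F. norm (g i))"
    using order_tendstoD(1)[OF S[unfolded has_sum_def], of "S - r"] \<open>r > 0\<close>
    unfolding eventually_finite_subsets_at_top by auto
  have "norm (\<Sum>\<^sub>\<infinity>i\<in>I. if q \<le> L i then g i else 0) < r" if q: "q \<ge> Suc (Max (L ` F))" for q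
  proof -
    have small: "\<not> q \<le> L i" if "i \<in> F" for i
    proof -
      have "L i \<le> Max (L ` F)"
        using F(1) that by (intro Max_ge) auto
      then show ?thesis
        using q by linarith
    qed
    have tail: "((\<lambda>i. if i \<in> F then 0 else norm (g i)) has_sum (S - (\<Sum>i\<in>F. norm (g i)))) I"
    proof -
      have "((\<lambda>i. if i \<in> F then norm (g i) else 0) has_sum (\<Sum>i\<in>F. norm (g i))) I"
        using F by (intro has_sum_finite_neutralI[of F]) auto
      then have "((\<lambda>i. norm (g i) - (if i \<in> F then norm (g i) else 0)) has_sum (S - (\<Sum>i\<in>F. norm (g i)))) I"
        using has_sum_add[OF S, of "\<lambda>i. - (if i \<in> F then norm (g i) else 0)" "- (\<Sum>i\<in>F. norm (g i))"]
        by (simp add: has_sum_uminus)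
      then show ?thesis
        by (rule has_sum_cong[THEN iffD1, rotated]) auto
    qed
    have sum1: "(\<lambda>i. norm (if q \<le> L i then g i else 0)) summable_on I"
      by (rule summable_on_comparison_test[OF assms]) auto
    have "norm (\<Sum>\<^sub>\<infinity>i\<in>I. if q \<le> L i then g i else 0) \<le> (\<Sum>\<^sub>\<infinity>i\<in>I. norm (if q \<le> L i then g i else 0))"
      using sum1 by (rule norm_infsum_bound)
    also have "\<dots> \<le> S - (\<Sum>i\<in>F. norm (g i))"
      by (rule has_sum_mono[OF has_sum_infsum[OF sum1] tail]) (use small in auto)
    finally show ?thesis
      using F(3) by linarith
  qed
  then show "\<exists>N. \<forall>q\<ge>N. norm ((\<Sum>\<^sub>\<infinity>i\<in>I. if q \<le> L i then g i else 0) - 0) < r"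
    by auto
qed

lemma sum_fun_apply: "(\<Sum>j\<in>A. F j) x = (\<Sum>j\<in>A. F j x)"
  for F :: "'j \<Rightarrow> 'x \<Rightarrow> 'a::comm_monoid_add"
  by (induction A rule: infinite_finite_induct) auto

text \<open>Heredity says that the span of the basis vectors indexed by \<open>C\<close> is
  invariant under the adjoints of the shifts, which makes compression to it multiplicative. The root
  condition makes the defect operator nonzero.\<close>

locale hereditary_words =
  fixes ns :: "nat list" and C :: "nat list list set"
  assumes C_words: "C \<subseteq> words ns"
    and hereditary: "\<And>i \<alpha> \<beta>. i < length ns \<Longrightarrow> prepend i \<alpha> \<beta> \<in> C \<Longrightarrow> \<beta> \<in> C"
    and root_in: "replicate (length ns) [] \<in> C"
begin

abbreviation root :: "nat list list" where
  "root \<equiv> replicate (length ns) []"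

lemma length_C: "\<beta> \<in> C \<Longrightarrow> length \<beta> = length ns"
  using C_words by (auto simp: words_def)

lemma strip_in_C:
  assumes "\<beta> \<in> C" "i < length ns"
  shows "strip i m \<beta> \<in> C"
proof (rule hereditary[OF assms(2)])
  have "prepend i (take m (\<beta> ! i)) (strip i m \<beta>) = \<beta>"
    using assms length_C[OF assms(1)] by (simp add: prepend_def strip_def)
  then show "prepend i (take m (\<beta> ! i)) (strip i m \<beta>) \<in> C"
    using assms by simp
qed

text \<open>Defined for a whole word \<open>\<alpha>\<close> at once, since the Berezin kernel
  involves adjoints of products along words; the generators are the words of length 1.\<close>

definition compressed_shift :: "nat \<Rightarrow> nat list \<Rightarrow> (nat list list \<Rightarrow> complex) \<Rightarrow> nat list list \<Rightarrow> complex" where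
  "compressed_shift i \<alpha> f =
     (\<lambda>\<beta>. if \<beta> \<in> C \<and> take (length \<alpha>) (\<beta> ! i) = \<alpha> then f (strip i (length \<alpha>) \<beta>) else 0)"

abbreviation T :: "nat \<Rightarrow> nat \<Rightarrow> (nat list list \<Rightarrow> complex) \<Rightarrow> nat list list \<Rightarrow> complex" where
  "T i j \<equiv> compressed_shift i [j]"

text \<open>The adjoint of \<open>compressed_shift\<close>. No cut-off to \<open>C\<close> appears:
  by heredity \<open>prepend i \<alpha> \<beta>\<close> lies outside \<open>C\<close> whenever
  \<open>\<beta>\<close> does, and there \<open>f\<close> vanishes.\<close>

definition backward_shift :: "nat \<Rightarrow> nat list \<Rightarrow> (nat list list \<Rightarrow> complex) \<Rightarrow> nat list list \<Rightarrow> complex" where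
  "backward_shift i \<alpha> f = (\<lambda>\<beta>. f (prepend i \<alpha> \<beta>))"

text \<open>\<open>strip\<close> is injective on the tuples that begin with \<open>\<alpha>\<close>
  in slot \<open>i\<close>, so the squared coefficients of the image are those of \<open>f\<close>
  at distinct indices.\<close>

lemma compressed_shift_l2:
  assumes i: "i < length ns" and f: "f \<in> car (l2 C)"
  shows "compressed_shift i \<alpha> f \<in> car (l2 C)" "hnorm (l2 C) (compressed_shift i \<alpha> f) \<le> hnorm (l2 C) f"
proof -
  have "(\<Sum>\<beta>\<in>F. (cmod (compressed_shift i \<alpha> f \<beta>))\<^sup>2) \<le> (hnorm (l2 C) f)\<^sup>2"
    if F: "finite F" "F \<subseteq> C" for F
  proof -
    let ?G = "{\<beta>\<in>F. take (length \<alpha>) (\<beta> ! i) = \<alpha>}"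
    have "(\<Sum>\<beta>\<in>F. (cmod (compressed_shift i \<alpha> f \<beta>))\<^sup>2) = (\<Sum>\<beta>\<in>?G. (cmod (f (strip i (length \<alpha>) \<beta>)))\<^sup>2)"
      using F by (intro sum.mono_neutral_cong_right) (auto simp: compressed_shift_def subset_iff)
    also have "\<dots> = (\<Sum>\<gamma>\<in>strip i (length \<alpha>) ` ?G. (cmod (f \<gamma>))\<^sup>2)"
    proof (subst sum.reindex)
      show "inj_on (strip i (length \<alpha>)) ?G"
        using F i by (intro inj_on_inverseI[of _ "prepend i \<alpha>"] prepend_strip) (auto simp: length_C subset_iff)
    qed simp
    also have "\<dots> \<le> (hnorm (l2 C) f)\<^sup>2"
      using F i by (intro l2_sum_le_norm[OF f]) (auto intro: strip_in_C)
    finally show ?thesis .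
  qed
  moreover have "compressed_shift i \<alpha> f \<beta> = 0" if "\<beta> \<notin> C" for \<beta>
    using that by (simp add: compressed_shift_def)
  ultimately show "compressed_shift i \<alpha> f \<in> car (l2 C)" "hnorm (l2 C) (compressed_shift i \<alpha> f) \<le> hnorm (l2 C) f"
    using l2I[of C "compressed_shift i \<alpha> f" "hnorm (l2 C) f"] by auto
qed

lemma backward_shift_l2:
  assumes i: "i < length ns" and f: "f \<in> car (l2 C)"
  shows "backward_shift i \<alpha> f \<in> car (l2 C)"
proof (rule l2I(1)[of C _ "hnorm (l2 C) f"])
  fix F
  assume F: "finite F" "F \<subseteq> C"
  let ?G = "{\<beta>\<in>F. prepend i \<alpha> \<beta> \<in> C}"
  have "(\<Sum>\<beta>\<in>F. (cmod (backward_shift i \<alpha> f \<beta>))\<^sup>2) = (\<Sum>\<beta>\<in>?G. (cmod (f (prepend i \<alpha> \<beta>)))\<^sup>2)"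
    using F l2_zero_outside[OF f]
    by (intro sum.mono_neutral_cong_right) (auto simp: backward_shift_def subset_iff)
  also have "\<dots> = (\<Sum>\<gamma>\<in>prepend i \<alpha> ` ?G. (cmod (f \<gamma>))\<^sup>2)"
  proof (subst sum.reindex)
    show "inj_on (prepend i \<alpha>) ?G"
      using F i by (intro inj_on_inverseI[of _ "strip i (length \<alpha>)"] strip_prepend) (auto simp: length_C subset_iff)
  qed simp
  also have "\<dots> \<le> (hnorm (l2 C) f)\<^sup>2"
    using F i by (intro l2_sum_le_norm[OF f]) auto
  finally show "(\<Sum>\<beta>\<in>F. (cmod (backward_shift i \<alpha> f \<beta>))\<^sup>2) \<le> (hnorm (l2 C) f)\<^sup>2" .
qed (use hereditary[OF i] l2_zero_outside[OF f] in \<open>auto simp: backward_shift_def\<close>)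

text \<open>Both inner products are the same sum: \<open>prepend i \<alpha>\<close> maps the tuples
  that stay in \<open>C\<close> bijectively onto the tuples of \<open>C\<close> whose slot
  \<open>i\<close> begins with \<open>\<alpha>\<close>.\<close>

lemma ip_compressed_shift:
  assumes i: "i < length ns" and z: "z \<in> car (l2 C)" and y: "y \<in> car (l2 C)"
  shows "ip (l2 C) (compressed_shift i \<alpha> z) y = ip (l2 C) z (backward_shift i \<alpha> y)"
proof (rule ip_l2_eqI)
  let ?D = "{\<beta>\<in>C. prepend i \<alpha> \<beta> \<in> C}" and ?R = "{\<beta>\<in>C. take (length \<alpha>) (\<beta> ! i) = \<alpha>}"
  have "((\<lambda>\<beta>. z \<beta> * cnj (backward_shift i \<alpha> y \<beta>)) has_sum ip (l2 C) z (backward_shift i \<alpha> y)) C"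
    using z backward_shift_l2[OF i y] by (rule l2_ip_has_sum)
  then have *: "((\<lambda>\<beta>. z (strip i (length \<alpha>) (prepend i \<alpha> \<beta>)) * cnj (y (prepend i \<alpha> \<beta>)))
      has_sum ip (l2 C) z (backward_shift i \<alpha> y)) ?D"
    by (rule has_sum_cong_neutral[THEN iffD1, rotated -1])
      (use i length_C l2_zero_outside[OF y] in \<open>auto simp: backward_shift_def strip_prepend\<close>)
  have "bij_betw (prepend i \<alpha>) ?D ?R"
    by (rule bij_betw_byWitness[where f' = "strip i (length \<alpha>)"])
      (use i length_C strip_in_C in \<open>auto simp: strip_prepend prepend_strip nth_prepend\<close>)
  with * have "((\<lambda>\<beta>. z (strip i (length \<alpha>) \<beta>) * cnj (y \<beta>)) has_sum ip (l2 C) z (backward_shift i \<alpha> y)) ?R"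
    by (rule has_sum_reindex_bij_betw[THEN iffD1, rotated])
  then show "((\<lambda>\<beta>. compressed_shift i \<alpha> z \<beta> * cnj (y \<beta>)) has_sum ip (l2 C) z (backward_shift i \<alpha> y)) C"
    by (rule has_sum_cong_neutral[THEN iffD1, rotated -1]) (auto simp: compressed_shift_def)
qed

lemma adj_T:
  assumes "i < length ns" "y \<in> car (l2 C)"
  shows "adj (l2 C) (l2 C) (T i j) y = backward_shift i [j] y"
  using assms by (intro adj_l2_eqI backward_shift_l2 ip_compressed_shift)

text \<open>Compression is multiplicative here because removing the first letter never leaves
  \<open>C\<close>, so the intermediate cut-off in the product has no effect.\<close>

lemma word_op_T:
  assumes "i < length ns" "f \<in> car (l2 C)"
  shows "word_op (T i) \<alpha> f = compressed_shift i \<alpha> f"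
proof (induction \<alpha>)
  case Nil
  show ?case
    using l2_zero_outside[OF assms(2)] by (auto simp: word_op_def compressed_shift_def strip_def)
next
  case (Cons j \<alpha>)
  have "T i j (compressed_shift i \<alpha> f) \<beta> = compressed_shift i (j # \<alpha>) f \<beta>" for \<beta>
  proof (cases "\<beta> \<in> C")
    case True
    then show ?thesis
      using assms(1) length_C[OF True] strip_in_C[OF True assms(1), of 1]
      by (cases "\<beta> ! i") (auto simp: compressed_shift_def strip_def)
  qed (simp add: compressed_shift_def)
  then have "T i j (compressed_shift i \<alpha> f) = compressed_shift i (j # \<alpha>) f"
    by blast
  then show ?case
    using Cons by (simp add: word_op_def)
qed

lemma adj_word_op_T:
  assumes "i < length ns" "y \<in> car (l2 C)"
  shows "adj (l2 C) (l2 C) (word_op (T i) \<alpha>) y = backward_shift i \<alpha> y"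
  using assms by (intro adj_l2_eqI backward_shift_l2) (auto simp: word_op_T ip_compressed_shift)

text \<open>The term for \<open>j\<close> keeps the coefficients at tuples of \<open>C\<close> that
  begin with \<open>j\<close> in slot \<open>i\<close> and whose remainder lies in \<open>S\<close>.
  All letters of a tuple in \<open>C\<close> are admissible, so exactly one \<open>j\<close>
  contributes to each nonempty slot.\<close>

lemma cp_map_restrict_to:
  assumes i: "i < length ns" and Y: "\<And>f. f \<in> car (l2 C) \<Longrightarrow> Y f = restrict_to S f" and f: "f \<in> car (l2 C)"
  shows "cp_map (l2 C) (ns ! i) (T i) Y f = restrict_to {\<beta>. \<beta> ! i \<noteq> [] \<and> strip i 1 \<beta> \<in> S} f"
proof
  fix \<beta>
  have "cp_map (l2 C) (ns ! i) (T i) Y f \<beta>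
      = (\<Sum>j<ns ! i. T i j (restrict_to S (backward_shift i [j] f)) \<beta>)"
    unfolding cp_map_def sum_fun_apply using i f by (simp add: adj_T Y backward_shift_l2)
  also have "\<dots> = (if \<beta> \<in> {\<beta>. \<beta> ! i \<noteq> [] \<and> strip i 1 \<beta> \<in> S} then f \<beta> else 0)"
  proof (cases "\<beta> \<in> C \<and> \<beta> ! i \<noteq> []")
    case True
    then obtain l \<alpha> where l: "\<beta> ! i = l # \<alpha>"
      by (meson list.exhaust)
    have "\<beta> \<in> words ns"
      using True C_words by blast
    then have len: "length \<beta> = length ns" and "set (\<beta> ! i) \<subseteq> {..<ns ! i}"
      using i by (auto simp: words_def)
    then have "l < ns ! i"
      by (simp add: l)
    have "T i j (restrict_to S (backward_shift i [j] f)) \<beta>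
        = (if l = j then (if strip i 1 \<beta> \<in> S then f \<beta> else 0) else 0)" for j
      using True l prepend_strip[of i \<beta> "[j]"] len i by (auto simp: compressed_shift_def backward_shift_def)
    then show ?thesis
      using True \<open>l < ns ! i\<close> by (simp add: sum.delta)
  next
    case False
    then show ?thesis
      using l2_zero_outside[OF f] by (auto simp: compressed_shift_def)
  qed
  finally show "cp_map (l2 C) (ns ! i) (T i) Y f \<beta>
      = (if \<beta> \<in> {\<beta>. \<beta> ! i \<noteq> [] \<and> strip i 1 \<beta> \<in> S} then f \<beta> else 0)" .
qed

text \<open>Each factor with exponent 1 subtracts the tuples with a nonempty slot \<open>i\<close>
  and thereby adds the condition that this slot is empty. The induction treats one slot at a
  time.\<close>

lemma defect_map_T:
  assumes p: "length p = length ns" "set p \<subseteq> {0, 1}" and f: "f \<in> car (l2 C)"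
  shows "defect_map (l2 C) ns T p (\<lambda>h. h) f
    = restrict_to {\<beta>. \<forall>i<length ns. p ! i = 1 \<longrightarrow> \<beta> ! i = []} f"
proof -
  have "foldr (\<circ>) (map (\<lambda>i. id_minus_cp (l2 C) (ns ! i) (T i) ^^ (p ! i)) is) id (\<lambda>h. h) f
      = restrict_to {\<beta>. \<forall>i\<in>set is. p ! i = 1 \<longrightarrow> \<beta> ! i = []} f"
    if "distinct is" "set is \<subseteq> {..<length ns}" "f \<in> car (l2 C)" for "is" f
    using that
  proof (induction "is" arbitrary: f)
    case Nil
    then show ?case
      by simp
  next
    case (Cons i "is")
    let ?Y = "foldr (\<circ>) (map (\<lambda>i. id_minus_cp (l2 C) (ns ! i) (T i) ^^ (p ! i)) is) id (\<lambda>h. h)"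
    let ?S = "{\<beta>. \<forall>i\<in>set is. p ! i = 1 \<longrightarrow> \<beta> ! i = []}"
    have i: "i < length ns" "i \<notin> set is"
      using Cons.prems by auto
    have Y: "?Y g = restrict_to ?S g" if "g \<in> car (l2 C)" for g
      by (rule Cons.IH) (use Cons.prems that in auto)
    let ?L = "foldr (\<circ>) (map (\<lambda>i. id_minus_cp (l2 C) (ns ! i) (T i) ^^ (p ! i)) (i # is)) id (\<lambda>h. h) f"
    have step: "?L = (id_minus_cp (l2 C) (ns ! i) (T i) ^^ (p ! i)) ?Y f"
      by (simp only: list.map foldr.simps o_apply)
    consider "p ! i = 0" | "p ! i = 1"
      using p i nth_mem[of i p] by fastforce
    then show ?case
    proof cases
      case 1
      have "?L = ?Y f"
        unfolding step by (simp only: 1 funpow.simps id_apply)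
      also have "\<dots> = restrict_to ?S f"
        using Cons.prems(3) by (rule Y)
      also have "\<dots> = restrict_to {\<beta>. \<forall>l\<in>set (i # is). p ! l = 1 \<longrightarrow> \<beta> ! l = []} f"
        using 1 by simp
      finally show ?thesis .
    next
      case 2
      have "id_minus_cp (l2 C) (ns ! i) (T i) ?Y f \<beta>
          = (if \<beta> \<in> ?S \<and> \<beta> ! i = [] then f \<beta> else 0)" for \<beta>
      proof (cases "\<beta> \<in> C")
        case True
        \<comment> \<open>The set \<open>?S\<close> constrains only the slots already treated, and
          \<open>i\<close> is not among them, so stripping slot \<open>i\<close> does not affect
          membership.\<close>
        have "strip i 1 \<beta> \<in> ?S \<longleftrightarrow> \<beta> \<in> ?S"
          using i length_C[OF True] by (auto simp: nth_strip)
        then show ?thesis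
          using Cons.prems(3) i Y by (auto simp: id_minus_cp_def cp_map_restrict_to[OF i(1) Y])
      next
        case False
        then show ?thesis
          using Cons.prems(3) i Y l2_zero_outside[OF Cons.prems(3)]
          by (auto simp: id_minus_cp_def cp_map_restrict_to[OF i(1) Y])
      qed
      then have "id_minus_cp (l2 C) (ns ! i) (T i) ?Y f
          = restrict_to {\<beta>. \<forall>l\<in>set (i # is). p ! l = 1 \<longrightarrow> \<beta> ! l = []} f"
        using 2 by (auto simp: fun_eq_iff)
      moreover have "?L = id_minus_cp (l2 C) (ns ! i) (T i) ?Y f"
        unfolding step by (simp only: 2 funpow.simps One_nat_def id_apply o_apply)
      ultimately show ?thesis
        by (rule trans[rotated])
    qed
  qed
  from this[of "[0..<length ns]" f] show ?thesis
    using f by (simp add: defect_map_def atLeast0LessThan Ball_def)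
qed

lemma defect_op_T:
  assumes "f \<in> car (l2 C)"
  shows "defect_op (l2 C) ns T f = restrict_to {root} f"
proof -
  have "\<beta> = root" if "\<beta> \<in> C" "\<forall>i<length ns. \<beta> ! i = []" for \<beta>
    using that length_C by (auto intro: nth_equalityI)
  then have "restrict_to {\<beta>. \<forall>i<length ns. replicate (length ns) (1::nat) ! i = 1 \<longrightarrow> \<beta> ! i = []} f = restrict_to {root} f"
    using l2_zero_outside[OF assms] by (auto simp: fun_eq_iff)
  then show ?thesis
    unfolding defect_op_def using assms by (subst defect_map_T) (auto simp: set_replicate_conv_if)
qed

text \<open>Operators in different slots commute because updates at different positions do.
  Positivity holds since every defect map sends the identity to a coordinate projection.\<close>

lemma T_in_polyball: "T \<in> polyball (l2 C) ns"
  unfolding polyball_def mem_Collect_eq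
proof (intro conjI allI impI ballI)
  fix i j
  assume i: "i < length ns"
  show "bounded_op (l2 C) (l2 C) (T i j)"
    unfolding bounded_op_def
  proof (intro conjI ballI allI exI)
    fix f
    assume f: "f \<in> car (l2 C)"
    show "T i j f \<in> car (l2 C)"
      by (rule compressed_shift_l2[OF i f])
    show "hnorm (l2 C) (T i j f) \<le> 1 * hnorm (l2 C) f"
      using compressed_shift_l2(2)[OF i f] by simp
  qed (auto simp: compressed_shift_def fun_eq_iff)
next
  fix s t i j f
  assume st: "s < length ns" "t < length ns" "s \<noteq> t"
  have "T s i (T t j f) \<beta> = T t j (T s i f) \<beta>" for \<beta>
  proof (cases "\<beta> \<in> C")
    case True
    then show ?thesis
      using st length_C[OF True] strip_in_C[OF True st(1), of 1] strip_in_C[OF True st(2), of 1]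
      by (auto simp: compressed_shift_def nth_strip) (auto simp: strip_def list_update_swap)
  qed (simp add: compressed_shift_def)
  then show "T s i (T t j f) = T t j (T s i f)"
    by blast
next
  fix p :: "nat list"
  assume "length p = length ns \<and> set p \<subseteq> {0, 1}"
  then show "positive_op (l2 C) (defect_map (l2 C) ns T p (\<lambda>h. h))"
    by (intro positive_restrict_to[OF defect_map_T]) auto
qed

text \<open>The \<open>q\<close>-th power of the map for slot \<open>i\<close> sends the identity to
  the projection onto tuples with at least \<open>q\<close> letters there, so the inner products are
  tails of an absolutely convergent sum.\<close>

lemma pure_T: "pure_tuple (l2 C) ns T"
  unfolding pure_tuple_def
proof (intro allI impI ballI)
  fix i x y
  assume i: "i < length ns" and x: "x \<in> car (l2 C)" and y: "y \<in> car (l2 C)"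
  have pow: "(cp_map (l2 C) (ns ! i) (T i) ^^ q) (\<lambda>h. h) f = restrict_to {\<beta>. q \<le> length (\<beta> ! i)} f"
    if "f \<in> car (l2 C)" for q f
    using that
  proof (induction q arbitrary: f)
    case (Suc q)
    have "\<beta> ! i \<noteq> [] \<and> strip i 1 \<beta> \<in> {\<beta>. q \<le> length (\<beta> ! i)} \<longleftrightarrow> Suc q \<le> length (\<beta> ! i)" if "\<beta> \<in> C" for \<beta>
      using i length_C[OF that] by (cases "\<beta> ! i") (auto simp: nth_strip)
    then show ?case
      using l2_zero_outside[OF Suc.prems] by (auto simp: cp_map_restrict_to[OF i Suc.IH Suc.prems] fun_eq_iff)
  qed simp
  have "ip (l2 C) ((cp_map (l2 C) (ns ! i) (T i) ^^ q) (\<lambda>h. h) x) y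
      = (\<Sum>\<^sub>\<infinity>\<beta>\<in>C. if q \<le> length (\<beta> ! i) then x \<beta> * cnj (y \<beta>) else 0)" for q
    unfolding pow[OF x] ip_l2 by (intro infsum_cong) auto
  then show "(\<lambda>q. ip (l2 C) ((cp_map (l2 C) (ns ! i) (T i) ^^ q) (\<lambda>h. h) x) y) \<longlonglongrightarrow> 0"
    using infsum_tail_tendsto_0[OF l2_abs_summable_mult[OF x y]] by simp
qed

lemma rank_T: "polyball_rank (l2 C) ns T = 1"
proof -
  interpret hilbert_space "l2 C"
    by (rule hilbert_space_l2)
  have range: "defect_op (l2 C) ns T ` car (l2 C) = span {fock_basis root}"
  proof (intro equalityI subsetI)
    fix g
    assume "g \<in> defect_op (l2 C) ns T ` car (l2 C)"
    then obtain f where "f \<in> car (l2 C)" "g = defect_op (l2 C) ns T f"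
      by blast
    then have "g = scl (l2 C) (f root) (fock_basis root)"
      by (auto simp: defect_op_T fock_basis_def)
    then show "g \<in> span {fock_basis root}"
      by (metis span_base span_scale singletonI)
  next
    fix g
    assume "g \<in> span {fock_basis root}"
    then obtain c where "g = scl (l2 C) c (fock_basis root)"
      by (auto simp: span_singleton)
    moreover have "scl (l2 C) c (fock_basis root) \<in> car (l2 C)"
      using fock_basis_in_l2[OF root_in] by (rule car_scl)
    ultimately show "g \<in> defect_op (l2 C) ns T ` car (l2 C)"
      by (intro image_eqI[of _ _ g]) (auto simp: defect_op_T fock_basis_def)
  qed
  have "fock_basis root \<noteq> 0"
    by (auto simp: fock_basis_def fun_eq_iff)
  then have "independent {fock_basis root}"
    by (simp add: dependent_single)
  then have "dim (span {fock_basis root}) = 1"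
    using dim_span_eq_card_independent[of "{fock_basis root}"] by simp
  then show ?thesis
    unfolding polyball_rank_def op_rank_def range by (auto simp: one_enat_def intro!: exI[of _ "{fock_basis root}"])
qed

text \<open>The adjoints of the words in \<open>\<beta>\<close> bring the coefficient of
  \<open>f\<close> at \<open>\<beta>\<close> to the root, and the defect operator, a projection and
  hence its own root, keeps that coefficient only. So the kernel is the inclusion into the full
  tensor product with a one-dimensional coefficient space.\<close>

lemma berezin_kernel_T:
  assumes f: "f \<in> car (l2 C)"
  shows "berezin_kernel (l2 C) ns T f \<beta> = (if \<beta> \<in> words ns then scl (l2 C) (f \<beta>) (fock_basis root) else 0)"
proof (cases "\<beta> \<in> words ns")
  case True
  interpret hilbert_space "l2 C"
    by (rule hilbert_space_l2)
  let ?D = "defect_op (l2 C) ns T"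
  let ?B = "\<lambda>is. foldr (\<circ>) (map (\<lambda>i. adj (l2 C) (l2 C) (word_op (T i) (\<beta> ! i))) is) id f"
  \<comment> \<open>The induction over the slots needs the value at every \<open>\<gamma>\<close>,
    since each further adjoint evaluates the previous function at a prepended tuple; afterwards
    \<open>\<gamma>\<close> becomes the root.\<close>
  have B: "?B is \<in> car (l2 C)
      \<and> (\<forall>\<gamma>. length \<gamma> = length ns \<longrightarrow>
          ?B is \<gamma> = f (map (\<lambda>i. if i \<in> set is then \<beta> ! i @ \<gamma> ! i else \<gamma> ! i) [0..<length ns]))"
    if "distinct is" "set is \<subseteq> {..<length ns}" for "is"
    using that
  proof (induction "is")
    case Nil
    have "map ((!) \<gamma>) [0..<length ns] = \<gamma>" if "length \<gamma> = length ns" for \<gamma> :: "nat list list"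
      using that map_nth[of \<gamma>] by simp
    then show ?case
      using f by simp
  next
    case (Cons i "is")
    then have i: "i < length ns" "i \<notin> set is"
      by auto
    have IH: "?B is \<in> car (l2 C)
      \<and> (\<forall>\<gamma>. length \<gamma> = length ns \<longrightarrow>
          ?B is \<gamma> = f (map (\<lambda>i. if i \<in> set is then \<beta> ! i @ \<gamma> ! i else \<gamma> ! i) [0..<length ns]))"
      by (rule Cons.IH) (use Cons.prems in auto)
    then have car: "?B is \<in> car (l2 C)"
      by (rule conjunct1)
    have "?B (i # is) \<gamma> = f (map (\<lambda>l. if l \<in> set (i # is) then \<beta> ! l @ \<gamma> ! l else \<gamma> ! l) [0..<length ns])"
      if "length \<gamma> = length ns" for \<gamma>
    proof -
      have "?B (i # is) \<gamma> = ?B is (prepend i (\<beta> ! i) \<gamma>)"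
        using adj_word_op_T[OF i(1) car] by (simp add: backward_shift_def)
      also have "\<dots> = f (map (\<lambda>l. if l \<in> set is then \<beta> ! l @ prepend i (\<beta> ! i) \<gamma> ! l
          else prepend i (\<beta> ! i) \<gamma> ! l) [0..<length ns])"
        by (rule IH[THEN conjunct2, rule_format]) (simp add: that)
      also have "\<dots> = f (map (\<lambda>l. if l \<in> set (i # is) then \<beta> ! l @ \<gamma> ! l else \<gamma> ! l) [0..<length ns])"
        using i that by (intro arg_cong[of _ _ f] map_cong) (auto simp: nth_prepend)
      finally show ?thesis .
    qed
    moreover have "?B (i # is) \<in> car (l2 C)"
      using adj_word_op_T[OF i(1) car] backward_shift_l2[OF i(1) car] by simp
    ultimately show ?case
      by blast
  qed
  have car: "?B [0..<length ns] \<in> car (l2 C)"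
    using B[of "[0..<length ns]"] by (simp add: atLeast0LessThan)
  have "map (\<lambda>i. \<beta> ! i @ root ! i) [0..<length ns] = \<beta>"
    using True by (auto simp: words_def intro: nth_equalityI)
  moreover have "?B [0..<length ns] root
      = f (map (\<lambda>i. if i \<in> set [0..<length ns] then \<beta> ! i @ root ! i else root ! i) [0..<length ns])"
    using B[of "[0..<length ns]"] by (simp add: atLeast0LessThan)
  moreover have "\<dots> = f (map (\<lambda>i. \<beta> ! i @ root ! i) [0..<length ns])"
    by (intro arg_cong[of _ _ f] map_cong) auto
  ultimately have at_root: "?B [0..<length ns] root = f \<beta>"
    by simp
  have "?D (?D g) = ?D g" if "g \<in> car (l2 C)" for g
    using defect_op_T[OF restrict_to_in_l2[OF that, of "{root}"]] that by (auto simp: defect_op_T)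
  then have "op_sqrt (l2 C) ?D (?B [0..<length ns]) = ?D (?B [0..<length ns])"
    using car by (intro op_sqrt_idempotent bounded_restrict_to[OF defect_op_T] positive_restrict_to[OF defect_op_T])
  also have "\<dots> = scl (l2 C) (f \<beta>) (fock_basis root)"
    using at_root by (auto simp: defect_op_T[OF car] fock_basis_def)
  finally show ?thesis
    using True by (simp add: berezin_kernel_def)
qed (simp add: berezin_kernel_def)

text \<open>With the kernel an inclusion, this is the compression of the level projection to
  \<open>l2 C\<close>. The adjoint is identified by testing: \<open>fock_basis root\<close> is a
  unit vector, so the inner product with coefficients in \<open>defect_space\<close> becomes the
  scalar one.\<close>

lemma compressed_level_proj:
  assumes q: "length q = length ns" and f: "f \<in> car (l2 C)"
  shows "(adj (l2 C) (ell2 (words ns) (defect_space (l2 C) ns T)) (berezin_kernel (l2 C) ns T)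
      \<circ> levels_proj q \<circ> berezin_kernel (l2 C) ns T) f
    = restrict_to {\<beta>\<in>C. \<forall>i<length ns. length (\<beta> ! i) = q ! i} f"
proof -
  interpret hilbert_space "l2 C"
    by (rule hilbert_space_l2)
  let ?P = "\<lambda>\<beta>. \<forall>i<length ns. length (\<beta> ! i) = q ! i"
  have e: "fock_basis root \<in> car (l2 C)" "ip (l2 C) (fock_basis root) (fock_basis root) = 1"
    using fock_basis_in_l2[OF root_in] ip_fock_basis[OF root_in] by (auto simp: fock_basis_def)
  have "adj (l2 C) (ell2 (words ns) (defect_space (l2 C) ns T)) (berezin_kernel (l2 C) ns T)
      (levels_proj q (berezin_kernel (l2 C) ns T f)) = restrict_to {\<beta>\<in>C. ?P \<beta>} f"
  proof (rule adj_l2_eqI[OF restrict_to_in_l2[OF f]])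
    fix z
    assume z: "z \<in> car (l2 C)"
    have "ip (ell2 (words ns) (defect_space (l2 C) ns T)) (berezin_kernel (l2 C) ns T z)
        (levels_proj q (berezin_kernel (l2 C) ns T f))
      = (\<Sum>\<^sub>\<infinity>\<beta>\<in>words ns. ip (l2 C) (berezin_kernel (l2 C) ns T z \<beta>)
          (levels_proj q (berezin_kernel (l2 C) ns T f) \<beta>))"
      by (simp add: ell2_def defect_space_def)
    also have "\<dots> = (\<Sum>\<^sub>\<infinity>\<beta>\<in>C. z \<beta> * cnj (restrict_to {\<beta>\<in>C. ?P \<beta>} f \<beta>))"
    proof (rule infsum_cong_neutral)
      fix \<beta>
      assume "\<beta> \<in> words ns - C"
      then show "ip (l2 C) (berezin_kernel (l2 C) ns T z \<beta>)
          (levels_proj q (berezin_kernel (l2 C) ns T f) \<beta>) = 0"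
        using l2_zero_outside[OF z, of \<beta>] by (simp add: berezin_kernel_T[OF z] ip_l2)
    next
      fix \<beta>
      assume "\<beta> \<in> words ns \<inter> C"
      then show "ip (l2 C) (berezin_kernel (l2 C) ns T z \<beta>)
          (levels_proj q (berezin_kernel (l2 C) ns T f) \<beta>) = z \<beta> * cnj (restrict_to {\<beta>\<in>C. ?P \<beta>} f \<beta>)"
        using q e by (auto simp: berezin_kernel_T z f levels_proj_apply ip_scl_left ip_scl_right simp del: scl_l2)
    qed (use C_words in auto)
    finally show "ip (ell2 (words ns) (defect_space (l2 C) ns T)) (berezin_kernel (l2 C) ns T z)
        (levels_proj q (berezin_kernel (l2 C) ns T f)) = ip (l2 C) z (restrict_to {\<beta>\<in>C. ?P \<beta>} f)"
      by (simp only: ip_l2)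
  qed
  then show ?thesis
    by simp
qed

end

section \<open>Densities of sets of words\<close>

definition bounded_sum_lists :: "nat \<Rightarrow> nat \<Rightarrow> nat list set" where
  "bounded_sum_lists k m = {q. length q = k \<and> sum_list q \<le> m}"

lemma finite_bounded_sum_lists: "finite (bounded_sum_lists k m)"
proof (rule finite_subset)
  show "bounded_sum_lists k m \<subseteq> {q. set q \<subseteq> {..m} \<and> length q = k}"
    unfolding bounded_sum_lists_def using member_le_sum_list order_trans by fastforce
qed (rule finite_lists_length_eq, simp)

text \<open>A slack entry \<open>m - sum_list q\<close> turns the inequality into an equality, which
  is counted by stars and bars. Hence the binomial normalization in curvature and multiplicity
  produces genuine averages.\<close>

lemma card_bounded_sum_lists: "card (bounded_sum_lists k m) = (m + k) choose k"
proof -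
  have "bij_betw (\<lambda>q. (m - sum_list q) # q) (bounded_sum_lists k m) {l. length l = Suc k \<and> sum_list l = m}"
    by (rule bij_betw_byWitness[where f' = tl]) (auto simp: bounded_sum_lists_def length_Suc_conv)
  then have "card (bounded_sum_lists k m) = card {l::nat list. length l = Suc k \<and> sum_list l = m}"
    by (rule bij_betw_same_card)
  also have "\<dots> = (m + k) choose m"
    by (simp add: card_length_sum_list)
  also have "\<dots> = (m + k) choose k"
    using binomial_symmetric[of m "m + k"] by simp
  finally show ?thesis .
qed

lemma sum_list_remove_nth:
  fixes q :: "nat list"
  assumes "i < length q"
  shows "sum_list q = q ! i + sum_list (take i q @ drop (Suc i) q)"
  using assms by (subst id_take_nth_drop[OF assms]) (simp add: add.left_commute)

text \<open>A list is determined by its entry \<open>i\<close>, with \<open>a\<close> possible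
  values, and by what remains after deleting it, a shorter list with sum still at most
  \<open>m\<close>.\<close>

lemma card_small_entry:
  assumes "i < Suc k"
  shows "card {q \<in> bounded_sum_lists (Suc k) m. q ! i < a} \<le> a * ((m + k) choose k)"
proof -
  have "card {q \<in> bounded_sum_lists (Suc k) m. q ! i < a} \<le> card ({..<a} \<times> bounded_sum_lists k m)"
  proof (rule card_inj_on_le)
    let ?f = "\<lambda>q. (q ! i, take i q @ drop (Suc i) q)"
    show "inj_on ?f {q \<in> bounded_sum_lists (Suc k) m. q ! i < a}"
    proof (rule inj_on_inverseI[where g = "\<lambda>(x, q). take i q @ x # drop i q"])
      fix q
      assume "q \<in> {q \<in> bounded_sum_lists (Suc k) m. q ! i < a}"
      then have "i < length q"
        using assms by (simp add: bounded_sum_lists_def)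
      then show "(case ?f q of (x, q) \<Rightarrow> take i q @ x # drop i q) = q"
        using id_take_nth_drop[of i q] by simp
    qed
    show "?f ` {q \<in> bounded_sum_lists (Suc k) m. q ! i < a} \<subseteq> {..<a} \<times> bounded_sum_lists k m"
    proof (intro image_subsetI)
      fix q
      assume "q \<in> {q \<in> bounded_sum_lists (Suc k) m. q ! i < a}"
      then show "?f q \<in> {..<a} \<times> bounded_sum_lists k m"
        using assms sum_list_remove_nth[of i q] by (auto simp: bounded_sum_lists_def)
    qed
  qed (simp add: finite_bounded_sum_lists)
  then show ?thesis
    by (simp add: card_cartesian_product card_bounded_sum_lists)
qed

text \<open>Lists with \<open>q ! i \<ge> a\<close> contribute an error of at most
  \<open>r / 2\<close> each. The others contribute at most \<open>B\<close>, and they form a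
  proportion of at most \<open>a * k / (m + k)\<close>, which tends to 0.\<close>

lemma averaged_limit:
  fixes d :: "nat \<Rightarrow> real"
  assumes d: "d \<longlonglongrightarrow> t" and i: "i < k"
  shows "(\<lambda>m. 1 / real ((m + k) choose k) * (\<Sum>q\<in>bounded_sum_lists k m. d (q ! i))) \<longlonglongrightarrow> t"
proof (rule LIMSEQ_I)
  fix r :: real
  assume "r > 0"
  then obtain a where a: "\<And>n. n \<ge> a \<Longrightarrow> \<bar>d n - t\<bar> < r / 2"
    using LIMSEQ_D[OF d, of "r / 2"] by auto
  have "(\<lambda>n. d n - t) \<longlonglongrightarrow> t - t"
    by (intro tendsto_intros d)
  then have "Bseq (\<lambda>n. d n - t)"
    by (rule convergent_imp_Bseq[OF convergentI])
  then obtain B where B: "B > 0" "\<And>n. \<bar>d n - t\<bar> \<le> B"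
    by (auto simp: Bseq_def)
  obtain k' where k: "k = Suc k'"
    using i by (cases k) auto
  have "(\<lambda>m. real a * B * real k * (1 / real (m + k))) \<longlonglongrightarrow> real a * B * real k * 0"
    by (intro tendsto_mult_left LIMSEQ_ignore_initial_segment lim_1_over_n)
  then have "eventually (\<lambda>m. real a * B * real k * (1 / real (m + k)) < r / 2) sequentially"
    by (rule order_tendstoD) (use \<open>r > 0\<close> in simp)
  then obtain M where M: "\<And>m. m \<ge> M \<Longrightarrow> real a * B * real k / (real m + real k) < r / 2"
    by (auto simp: eventually_sequentially)
  have "\<bar>1 / real ((m + k) choose k) * (\<Sum>q\<in>bounded_sum_lists k m. d (q ! i)) - t\<bar> < r" if "m \<ge> M" for m
  proof -
    let ?Q = "bounded_sum_lists k m" and ?c = "real ((m + k) choose k)"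
    have c: "?c > 0"
      by (simp add: zero_less_binomial)
    have "(\<Sum>q\<in>?Q. d (q ! i)) - ?c * t = (\<Sum>q\<in>?Q. d (q ! i) - t)"
      by (simp add: sum_subtractf card_bounded_sum_lists)
    then have "\<bar>(\<Sum>q\<in>?Q. d (q ! i)) - ?c * t\<bar> \<le> (\<Sum>q\<in>?Q. \<bar>d (q ! i) - t\<bar>)"
      by (simp add: sum_abs)
    also have "\<dots> \<le> (\<Sum>q\<in>?Q. r / 2 + (if q ! i < a then B else 0))"
    proof (rule sum_mono)
      fix q
      show "\<bar>d (q ! i) - t\<bar> \<le> r / 2 + (if q ! i < a then B else 0)"
        using a[of "q ! i"] B(2)[of "q ! i"] \<open>r > 0\<close> by (cases "q ! i < a") auto
    qed
    also have "\<dots> = ?c * (r / 2) + B * real (card {q \<in> ?Q. q ! i < a})"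
      by (simp add: sum.distrib card_bounded_sum_lists sum.If_cases finite_bounded_sum_lists Int_def)
    also have "real (card {q \<in> ?Q. q ! i < a}) \<le> real (a * ((m + k') choose k'))"
      using card_small_entry[of i k' m a] i k by (simp only: of_nat_le_iff)
    finally have "\<bar>(\<Sum>q\<in>?Q. d (q ! i)) - ?c * t\<bar> \<le> ?c * (r / 2) + B * real (a * ((m + k') choose k'))"
      using B by simp
    \<comment> \<open>The ratio of the sizes of the simplices in dimensions \<open>k - 1\<close> and
      \<open>k\<close>, by absorption for binomial coefficients.\<close>
    moreover have "real ((m + k') choose k') = ?c * (real k / (real m + real k))"
    proof -
      have "k * ((m + k) choose k) = (m + k) * ((m + k') choose k')"
        using binomial_absorption[of k' "m + k"] by (simp add: k)
      then have "real k * ?c = (real m + real k) * real ((m + k') choose k')"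
        by (metis of_nat_add of_nat_mult)
      then show ?thesis
        using k by (simp add: field_simps)
    qed
    ultimately have "\<bar>(\<Sum>q\<in>?Q. d (q ! i)) - ?c * t\<bar> \<le> ?c * (r / 2 + real a * B * real k / (real m + real k))"
      by (simp add: algebra_simps)
    also have "r / 2 + real a * B * real k / (real m + real k) < r"
      using M[OF that] by linarith
    finally have "\<bar>(\<Sum>q\<in>?Q. d (q ! i)) - ?c * t\<bar> / ?c < r"
      using c by (simp add: pos_divide_less_eq mult.commute)
    moreover have "1 / ?c * (\<Sum>q\<in>?Q. d (q ! i)) - t = ((\<Sum>q\<in>?Q. d (q ! i)) - ?c * t) / ?c"
      using c by (simp add: field_simps)
    ultimately show ?thesis
      using c by (simp add: abs_divide)
  qed
  then show "\<exists>M. \<forall>m\<ge>M. norm (1 / real ((m + k) choose k) * (\<Sum>q\<in>bounded_sum_lists k m. d (q ! i)) - t) < r"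
    by auto
qed

section \<open>Words as expansions in base \<open>n\<close>\<close>

primrec code :: "nat \<Rightarrow> nat list \<Rightarrow> nat" where
  "code n [] = 0"
| "code n (j # \<alpha>) = j + n * code n \<alpha>"

definition level_words :: "nat \<Rightarrow> nat \<Rightarrow> nat list set" where
  "level_words n l = {\<alpha>. length \<alpha> = l \<and> set \<alpha> \<subseteq> {..<n}}"

text \<open>Expansion with exactly \<open>l\<close> digits, zeros allowed at the top: the first
  letter is the remainder modulo \<open>n\<close> and the rest encodes the quotient.\<close>

lemma bij_betw_code: "bij_betw (code n) (level_words n l) {..<n ^ l}"
proof (induction l)
  case 0
  have "level_words n 0 = {[]}"
    by (auto simp: level_words_def)
  then show ?case
    by (auto simp: bij_betw_def)
next
  case (Suc l)
  show ?case
    unfolding bij_betw_def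
  proof
    show "inj_on (code n) (level_words n (Suc l))"
    proof (rule inj_onI)
      fix \<alpha> \<beta>
      assume "\<alpha> \<in> level_words n (Suc l)" "\<beta> \<in> level_words n (Suc l)" and eq: "code n \<alpha> = code n \<beta>"
      then obtain j \<alpha>' j' \<beta>' where *: "\<alpha> = j # \<alpha>'" "\<beta> = j' # \<beta>'" "j < n" "j' < n"
          "\<alpha>' \<in> level_words n l" "\<beta>' \<in> level_words n l"
        by (auto simp: level_words_def length_Suc_conv)
      have "code n \<alpha> mod n = j" "code n \<beta> mod n = j'" "code n \<alpha> div n = code n \<alpha>'" "code n \<beta> div n = code n \<beta>'"
        using * by auto
      then have "j = j'" "code n \<alpha>' = code n \<beta>'"
        using eq by metis+
      then show "\<alpha> = \<beta>"
        using * Suc by (auto simp: bij_betw_def inj_on_def)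
    qed
    show "code n ` level_words n (Suc l) = {..<n ^ Suc l}"
    proof (intro equalityI subsetI)
      fix x
      assume "x \<in> code n ` level_words n (Suc l)"
      then obtain j \<alpha> where *: "x = j + n * code n \<alpha>" "j < n" "\<alpha> \<in> level_words n l"
        by (auto simp: level_words_def length_Suc_conv)
      then have "Suc (code n \<alpha>) \<le> n ^ l"
        using bij_betwE[OF Suc] by (auto simp: Suc_le_eq)
      then have "n * Suc (code n \<alpha>) \<le> n * n ^ l"
        by (rule mult_le_mono2)
      then show "x \<in> {..<n ^ Suc l}"
        using * by simp
    next
      fix x
      assume x: "x \<in> {..<n ^ Suc l}"
      then have n: "n > 0"
        by (cases n) auto
      have "x div n < n ^ l"
        using x n by (simp add: less_mult_imp_div_less mult.commute)
      then have "x div n \<in> code n ` level_words n l"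
        using bij_betw_imp_surj_on[OF Suc] by simp
      then obtain \<alpha> where "\<alpha> \<in> level_words n l" "code n \<alpha> = x div n"
        by (metis imageE)
      then have "x mod n # \<alpha> \<in> level_words n (Suc l)" "code n (x mod n # \<alpha>) = x"
        using n by (auto simp: level_words_def)
      then show "x \<in> code n ` level_words n (Suc l)"
        by (metis imageI)
    qed
  qed
qed

lemma card_level_words: "card (level_words n l) = n ^ l"
  using bij_betw_same_card[OF bij_betw_code, of n l] by simp

lemma finite_level_words: "finite (level_words n l)"
  using bij_betw_finite[OF bij_betw_code, of n l] by simp

text \<open>The number attached to \<open>\<alpha>\<close> is
  \<open>code n \<alpha> / n ^ length \<alpha>\<close>; the condition is written without the
  division.\<close>

definition initial_words :: "nat \<Rightarrow> real \<Rightarrow> nat list set" where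
  "initial_words n t = {\<alpha>. real (code n \<alpha>) \<le> t * real n ^ length \<alpha>}"

lemma Nil_in_initial_words: "0 \<le> t \<Longrightarrow> [] \<in> initial_words n t"
  by (simp add: initial_words_def)

text \<open>Removing the first letter \<open>j\<close> drops the nonnegative summand
  \<open>j\<close> from the code and cancels one factor \<open>n\<close> on both sides.\<close>

lemma initial_words_suffix:
  assumes "n > 0" "\<alpha> @ \<beta> \<in> initial_words n t"
  shows "\<beta> \<in> initial_words n t"
  using assms(2)
proof (induction \<alpha>)
  case (Cons j \<alpha>)
  have "real n * real (code n (\<alpha> @ \<beta>)) \<le> real n * (t * real n ^ length (\<alpha> @ \<beta>))"
    using Cons.prems by (simp add: initial_words_def algebra_simps)
  then have "\<alpha> @ \<beta> \<in> initial_words n t"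
    using assms(1) by (simp add: initial_words_def)
  then show ?case
    by (rule Cons.IH)
qed simp

text \<open>Through \<open>code\<close> the count becomes that of the integers \<open>x < N\<close>
  with \<open>x \<le> t * N\<close>, which differs from \<open>t * N\<close> by at most 1.\<close>

lemma density_initial_words:
  assumes n: "n \<ge> 2" and t: "0 \<le> t" "t \<le> 1"
  shows "(\<lambda>l. real (card (level_words n l \<inter> initial_words n t)) / real (n ^ l)) \<longlonglongrightarrow> t"
proof -
  have close: "\<bar>real (card (level_words n l \<inter> initial_words n t)) / real (n ^ l) - t\<bar> \<le> (1 / real n) ^ l" for l
  proof -
    define N where "N = n ^ l"
    have N: "real N > 0"
      using n by (simp add: N_def)
    have "level_words n l \<inter> initial_words n t = {\<alpha> \<in> level_words n l. code n \<alpha> \<in> {x. real x \<le> t * real N}}"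
      by (auto simp: level_words_def initial_words_def N_def)
    moreover have "bij_betw (code n) {\<alpha> \<in> level_words n l. code n \<alpha> \<in> {x. real x \<le> t * real N}}
        {x \<in> {..<N}. x \<in> {x. real x \<le> t * real N}}"
      using bij_betw_code[of n l] unfolding N_def[symmetric] by (auto simp: bij_betw_def inj_on_def)
    ultimately have "card (level_words n l \<inter> initial_words n t) = card {x \<in> {..<N}. real x \<le> t * real N}"
      using bij_betw_same_card by force
    \<comment> \<open>The minimum matters only for \<open>t = 1\<close>, where the floor plus one
      would exceed \<open>N\<close>.\<close>
    also have "{x \<in> {..<N}. real x \<le> t * real N} = {..<min N (Suc (nat \<lfloor>t * real N\<rfloor>))}"
    proof -
      have "real x \<le> t * real N \<longleftrightarrow> x < Suc (nat \<lfloor>t * real N\<rfloor>)" for x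
        using t by (simp add: less_Suc_eq_le le_nat_iff le_floor_iff)
      then show ?thesis
        by (simp only: set_eq_iff mem_Collect_eq lessThan_iff min_less_iff_conj simp_thms)
    qed
    finally have card: "card (level_words n l \<inter> initial_words n t) = min N (Suc (nat \<lfloor>t * real N\<rfloor>))"
      by simp
    have tN: "0 \<le> t * real N" "t * real N \<le> real N"
      using t N mult_right_mono[of t 1 "real N"] by simp_all
    define M where "M = nat \<lfloor>t * real N\<rfloor>"
    have "real M \<le> t * real N" "t * real N < real M + 1"
      unfolding M_def using tN by linarith+
    then have "t * real N \<le> real (card (level_words n l \<inter> initial_words n t))"
        "real (card (level_words n l \<inter> initial_words n t)) \<le> t * real N + 1"
      unfolding card M_def[symmetric] using tN(2) by (auto simp: min_def)
    then have "\<bar>real (card (level_words n l \<inter> initial_words n t)) - t * real N\<bar> / real N \<le> 1 / real N"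
      by (intro divide_right_mono) auto
    moreover have "real (card (level_words n l \<inter> initial_words n t)) / real N - t
        = (real (card (level_words n l \<inter> initial_words n t)) - t * real N) / real N"
      using N by (simp add: field_simps)
    ultimately have "\<bar>real (card (level_words n l \<inter> initial_words n t)) / real N - t\<bar> \<le> 1 / real N"
      by (simp add: abs_divide)
    then show ?thesis
      by (simp add: N_def power_divide)
  qed
  have "(\<lambda>l. (1 / real n) ^ l) \<longlonglongrightarrow> 0"
    using n by (intro LIMSEQ_realpow_zero) auto
  then have "(\<lambda>l. real (card (level_words n l \<inter> initial_words n t)) / real (n ^ l) - t) \<longlonglongrightarrow> 0"
    by (rule Lim_null_comparison[rotated]) (use close in auto)
  then show ?thesis
    by (simp add: LIM_zero_iff)
qed

section \<open>Counting tuples of words of prescribed lengths\<close>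

definition multilevel :: "nat list \<Rightarrow> nat list \<Rightarrow> nat list list set" where
  "multilevel ns q = {\<beta> \<in> words ns. \<forall>i<length ns. length (\<beta> ! i) = q ! i}"

lemma finite_multilevel: "finite (multilevel ns q)"
proof (rule finite_subset)
  let ?X = "\<Union>i<length ns. level_words (ns ! i) (q ! i)"
  show "multilevel ns q \<subseteq> {\<beta>. set \<beta> \<subseteq> ?X \<and> length \<beta> = length ns}"
  proof
    fix \<beta>
    assume \<beta>: "\<beta> \<in> multilevel ns q"
    then have "\<beta> ! i \<in> level_words (ns ! i) (q ! i)" if "i < length ns" for i
      using that by (auto simp: multilevel_def words_def level_words_def)
    then show "\<beta> \<in> {\<beta>. set \<beta> \<subseteq> ?X \<and> length \<beta> = length ns}"
      using \<beta> by (fastforce simp: multilevel_def words_def in_set_conv_nth)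
  qed
  show "finite {\<beta>. set \<beta> \<subseteq> ?X \<and> length \<beta> = length ns}"
    by (intro finite_lists_length_eq finite_UN_I finite_level_words) auto
qed

text \<open>The letter 0 is available in every slot. This keeps the denominators in the averages
  nonzero.\<close>

lemma multilevel_nonempty:
  assumes "\<forall>n\<in>set ns. 1 \<le> n" "length q = length ns"
  shows "multilevel ns q \<noteq> {}"
proof -
  have "map (\<lambda>l. replicate l 0) q \<in> multilevel ns q"
    using assms by (auto simp: multilevel_def words_def set_replicate_conv_if in_set_conv_nth Suc_le_eq)
  then show ?thesis
    by blast
qed

text \<open>Slot \<open>i\<close> is split off as a factor. An empty word stays behind as a
  placeholder, which is why the remaining slots are counted by \<open>q[i := 0]\<close>.\<close>

lemma card_multilevel_slot:
  assumes i: "i < length ns" and q: "length q = length ns"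
  shows "card {\<beta> \<in> multilevel ns q. \<beta> ! i \<in> A}
    = card (level_words (ns ! i) (q ! i) \<inter> A) * card (multilevel ns (q[i := 0]))"
proof -
  have "bij_betw (\<lambda>\<beta>. (\<beta> ! i, \<beta>[i := []])) {\<beta> \<in> multilevel ns q. \<beta> ! i \<in> A}
      ((level_words (ns ! i) (q ! i) \<inter> A) \<times> multilevel ns (q[i := 0]))"
  proof (rule bij_betw_byWitness[where f' = "\<lambda>(\<alpha>, \<beta>). \<beta>[i := \<alpha>]"])
    show "(\<lambda>\<beta>. (\<beta> ! i, \<beta>[i := []])) ` {\<beta> \<in> multilevel ns q. \<beta> ! i \<in> A}
        \<subseteq> (level_words (ns ! i) (q ! i) \<inter> A) \<times> multilevel ns (q[i := 0])"
      using i q by (auto simp: multilevel_def words_def level_words_def nth_list_update split: if_splits)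
        (metis lessThan_iff subsetD)
    show "(\<lambda>(\<alpha>, \<beta>). \<beta>[i := \<alpha>]) ` ((level_words (ns ! i) (q ! i) \<inter> A) \<times> multilevel ns (q[i := 0]))
        \<subseteq> {\<beta> \<in> multilevel ns q. \<beta> ! i \<in> A}"
      using i q by (auto simp: multilevel_def words_def level_words_def nth_list_update split: if_splits)
        (metis lessThan_iff subsetD)+
    have "\<beta>[i := []] = \<beta>" if "\<beta> \<in> multilevel ns (q[i := 0])" for \<beta>
    proof -
      have "\<beta> ! i = []"
        using that i q by (auto simp: multilevel_def)
      then show ?thesis
        by (metis list_update_id)
    qed
    then show "\<forall>p\<in>(level_words (ns ! i) (q ! i) \<inter> A) \<times> multilevel ns (q[i := 0]).
        (\<lambda>\<beta>. (\<beta> ! i, \<beta>[i := []])) ((\<lambda>(\<alpha>, \<beta>). \<beta>[i := \<alpha>]) p) = p"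
      using i by (auto simp: multilevel_def words_def)
  qed (use i in auto)
  from bij_betw_same_card[OF this] show ?thesis
    by (simp only: card_cartesian_product)
qed

text \<open>The factor of the other slots is the same for \<open>A\<close> and for
  \<open>UNIV\<close> and cancels, leaving the proportion in a single slot.\<close>

lemma multilevel_ratio:
  assumes pos: "\<forall>n\<in>set ns. 1 \<le> n" and i: "i < length ns" and q: "length q = length ns"
  shows "real (card {\<beta> \<in> multilevel ns q. \<beta> ! i \<in> A}) / real (card (multilevel ns q))
    = real (card (level_words (ns ! i) (q ! i) \<inter> A)) / real (ns ! i ^ (q ! i))"
proof -
  have "card (multilevel ns (q[i := 0])) > 0"
    using multilevel_nonempty[OF pos, of "q[i := 0]"] q finite_multilevel by (simp add: card_gt_0_iff)
  then show ?thesis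
    using card_multilevel_slot[OF i q, of A] card_multilevel_slot[OF i q, of UNIV]
    by (simp add: card_level_words)
qed

section \<open>Curvature and multiplicity\<close>

lemma trace_levels_proj:
  assumes "length q = length ns"
  shows "op_trace (fock ns) (levels_proj q) = of_nat (card (multilevel ns q))"
  unfolding fock_def
proof (rule op_trace_coordinate_proj[OF finite_multilevel])
  show "multilevel ns q \<subseteq> words ns"
    by (auto simp: multilevel_def)
  fix f
  assume "f \<in> car (l2 (words ns))"
  then show "levels_proj q f = restrict_to (multilevel ns q) f"
    using assms l2_zero_outside[of f "words ns"] by (auto simp: levels_proj_apply multilevel_def fun_eq_iff)
qed

lemma multiplicity_seq_l2:
  assumes "J \<subseteq> words ns"
  shows "multiplicity_seq ns (car (l2 J)) m =
    1 / of_nat ((m + length ns) choose length ns) *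
    (\<Sum>q\<in>bounded_sum_lists (length ns) m. of_nat (card (multilevel ns q \<inter> J)) / of_nat (card (multilevel ns q)))"
proof -
  have "op_trace (fock ns) (ortho_proj (fock ns) (car (l2 J)) \<circ> levels_proj q) = of_nat (card (multilevel ns q \<inter> J))"
    if q: "length q = length ns" for q
    unfolding fock_def
  proof (rule op_trace_coordinate_proj)
    show "finite (multilevel ns q \<inter> J)"
      using finite_multilevel by blast
    show "multilevel ns q \<inter> J \<subseteq> words ns"
      using assms by blast
    fix f
    assume f: "f \<in> car (l2 (words ns))"
    have "levels_proj q f = restrict_to (multilevel ns q) f"
      using q l2_zero_outside[OF f] by (auto simp: levels_proj_apply multilevel_def fun_eq_iff)
    then have "(ortho_proj (l2 (words ns)) (car (l2 J)) \<circ> levels_proj q) f = restrict_to J (restrict_to (multilevel ns q) f)"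
      using ortho_proj_l2[OF assms restrict_to_in_l2[OF f]] by (simp only: o_apply)
    also have "\<dots> = restrict_to (multilevel ns q \<inter> J) f"
      by auto
    finally show "(ortho_proj (l2 (words ns)) (car (l2 J)) \<circ> levels_proj q) f = restrict_to (multilevel ns q \<inter> J) f" .
  qed
  then show ?thesis
    by (simp add: multiplicity_seq_def bounded_sum_lists_def trace_levels_proj)
qed

text \<open>These are the same averages as in \<open>multiplicity_seq_l2\<close>, with
  \<open>C\<close> for \<open>J\<close>, so one limit result serves curvature and
  multiplicity.\<close>

lemma (in hereditary_words) curv_seq_T:
  "curv_seq (l2 C) ns T m =
    1 / of_nat ((m + length ns) choose length ns) *
    (\<Sum>q\<in>bounded_sum_lists (length ns) m. of_nat (card (multilevel ns q \<inter> C)) / of_nat (card (multilevel ns q)))"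
proof -
  have "op_trace (l2 C) (adj (l2 C) (ell2 (words ns) (defect_space (l2 C) ns T)) (berezin_kernel (l2 C) ns T)
      \<circ> levels_proj q \<circ> berezin_kernel (l2 C) ns T) = of_nat (card (multilevel ns q \<inter> C))"
    if q: "length q = length ns" for q
  proof (rule op_trace_coordinate_proj)
    show "finite (multilevel ns q \<inter> C)"
      using finite_multilevel by blast
    have "multilevel ns q \<inter> C = {\<beta>\<in>C. \<forall>i<length ns. length (\<beta> ! i) = q ! i}"
      using C_words by (auto simp: multilevel_def)
    then show "(adj (l2 C) (ell2 (words ns) (defect_space (l2 C) ns T)) (berezin_kernel (l2 C) ns T)
      \<circ> levels_proj q \<circ> berezin_kernel (l2 C) ns T) f = restrict_to (multilevel ns q \<inter> C) f"
      if "f \<in> car (l2 C)" for f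
      using compressed_level_proj[OF q that] by (simp only:)
  qed simp
  then show ?thesis
    by (simp add: curv_seq_def bounded_sum_lists_def trace_levels_proj)
qed

lemma multilevel_average_tendsto:
  assumes pos: "\<forall>n\<in>set ns. 1 \<le> n" and i: "i < length ns"
    and density: "(\<lambda>l. real (card (level_words (ns ! i) l \<inter> A)) / real (ns ! i ^ l)) \<longlonglongrightarrow> t"
  shows "(\<lambda>m. 1 / of_nat ((m + length ns) choose length ns) *
    (\<Sum>q\<in>bounded_sum_lists (length ns) m.
      of_nat (card (multilevel ns q \<inter> {\<beta> \<in> words ns. \<beta> ! i \<in> A})) / of_nat (card (multilevel ns q))))
    \<longlonglongrightarrow> complex_of_real t"
proof -
  have "real (card (multilevel ns q \<inter> {\<beta> \<in> words ns. \<beta> ! i \<in> A})) / real (card (multilevel ns q))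
      = real (card (level_words (ns ! i) (q ! i) \<inter> A)) / real (ns ! i ^ (q ! i))"
    if "q \<in> bounded_sum_lists (length ns) m" for q m
  proof -
    have "multilevel ns q \<inter> {\<beta> \<in> words ns. \<beta> ! i \<in> A} = {\<beta> \<in> multilevel ns q. \<beta> ! i \<in> A}"
      by (auto simp: multilevel_def)
    then show ?thesis
      using multilevel_ratio[OF pos i, of q A] that by (simp add: bounded_sum_lists_def)
  qed
  then have "(\<lambda>m. 1 / real ((m + length ns) choose length ns) *
      (\<Sum>q\<in>bounded_sum_lists (length ns) m.
        real (card (multilevel ns q \<inter> {\<beta> \<in> words ns. \<beta> ! i \<in> A})) / real (card (multilevel ns q)))) \<longlonglongrightarrow> t"
    using averaged_limit[OF density i] by simp
  from tendsto_of_real[OF this, where 'a = complex] show ?thesis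
    by simp
qed

text \<open>The shift moves the coefficients along the injective map \<open>prepend i [j]\<close>,
  which keeps indices in \<open>J\<close>. The image of \<open>f\<close> is thus supported in
  \<open>J\<close>, and its squared coefficients are those of \<open>f\<close> at distinct
  indices.\<close>

lemma invariant_subspace_l2:
  assumes "J \<subseteq> words ns"
    and prepend: "\<And>i j \<beta>. i < length ns \<Longrightarrow> j < ns ! i \<Longrightarrow> \<beta> \<in> J \<Longrightarrow> prepend i [j] \<beta> \<in> J"
  shows "invariant_subspace ns (car (l2 J))"
proof -
  have len: "length \<beta> = length ns" if "\<beta> \<in> J" for \<beta>
    using assms(1) that by (auto simp: words_def)
  have "shift i j f \<in> car (l2 J)" if i: "i < length ns" and j: "j < ns ! i" and f: "f \<in> car (l2 J)" for i j f
  proof -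
    have eq: "shift i j f \<beta> = (if \<beta> ! i \<noteq> [] \<and> hd (\<beta> ! i) = j then f (strip i 1 \<beta>) else 0)" for \<beta>
      by (cases "\<beta> ! i") (auto simp: shift_def at_slot_def creation_def strip_def)
    have in_J: "\<beta> \<in> J \<and> strip i 1 \<beta> \<in> J" if "shift i j f \<beta> \<noteq> 0" for \<beta>
    proof -
      have *: "\<beta> ! i \<noteq> []" "hd (\<beta> ! i) = j" "strip i 1 \<beta> \<in> J"
        using that l2_zero_outside[OF f] by (auto simp: eq split: if_splits)
      then have "prepend i [j] (strip i 1 \<beta>) = \<beta>"
        using prepend_strip[of i \<beta> "[j]"] len[OF *(3)] i by (cases "\<beta> ! i") auto
      then show ?thesis
        using prepend[OF i j *(3)] * by simp
    qed
    show ?thesis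
    proof (rule l2I(1)[of J _ "hnorm (l2 J) f"])
      fix F
      assume F: "finite F" "F \<subseteq> J"
      let ?G = "{\<beta>\<in>F. shift i j f \<beta> \<noteq> 0}"
      have "(\<Sum>\<beta>\<in>F. (cmod (shift i j f \<beta>))\<^sup>2) = (\<Sum>\<beta>\<in>?G. (cmod (f (strip i 1 \<beta>)))\<^sup>2)"
        using F by (intro sum.mono_neutral_cong_right) (auto simp: eq split: if_splits)
      also have "\<dots> = (\<Sum>\<gamma>\<in>strip i 1 ` ?G. (cmod (f \<gamma>))\<^sup>2)"
      proof (subst sum.reindex)
        show "inj_on (strip i 1) ?G"
        proof (rule inj_on_inverseI[of _ "prepend i [j]"])
          fix \<beta>
          assume "\<beta> \<in> ?G"
          then have "\<beta> ! i \<noteq> []" "hd (\<beta> ! i) = j" "length \<beta> = length ns"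
            using F len by (auto simp: eq split: if_splits)
          then show "prepend i [j] (strip i 1 \<beta>) = \<beta>"
            using prepend_strip[of i \<beta> "[j]"] i by (cases "\<beta> ! i") auto
        qed
      qed simp
      also have "\<dots> \<le> (hnorm (l2 J) f)\<^sup>2"
        using F in_J by (intro l2_sum_le_norm[OF f]) auto
      finally show "(\<Sum>\<beta>\<in>F. (cmod (shift i j f \<beta>))\<^sup>2) \<le> (hnorm (l2 J) f)\<^sup>2" .
    qed (use in_J in auto)
  qed
  then show ?thesis
    using closed_subspace_l2[OF assms(1)] by (simp add: invariant_subspace_def fock_def)
qed

section \<open>Hereditary sets of prescribed density and the conclusion\<close>

definition initial_tuples :: "nat list \<Rightarrow> nat \<Rightarrow> real \<Rightarrow> nat list list set" where
  "initial_tuples ns i t = {\<beta> \<in> words ns. \<beta> ! i \<in> initial_words (ns ! i) t}"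

text \<open>Prepending in another slot leaves slot \<open>i\<close> alone; prepending in slot
  \<open>i\<close> is covered by \<open>initial_words_suffix\<close>.\<close>

lemma hereditary_initial_tuples:
  assumes i: "i < length ns" and n: "2 \<le> ns ! i" and t: "0 \<le> t"
  shows "hereditary_words ns (initial_tuples ns i t)"
proof
  show "initial_tuples ns i t \<subseteq> words ns"
    by (auto simp: initial_tuples_def)
  show "replicate (length ns) [] \<in> initial_tuples ns i t"
    using i t by (simp add: initial_tuples_def words_def Nil_in_initial_words)
  fix l \<alpha> \<beta>
  assume l: "l < length ns" and *: "prepend l \<alpha> \<beta> \<in> initial_tuples ns i t"
  then have len: "length \<beta> = length ns" and letters: "\<And>m. m < length ns \<Longrightarrow> set (prepend l \<alpha> \<beta> ! m) \<subseteq> {..<ns ! m}"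
    and init: "prepend l \<alpha> \<beta> ! i \<in> initial_words (ns ! i) t"
    by (auto simp: initial_tuples_def words_def)
  have "set (\<beta> ! m) \<subseteq> {..<ns ! m}" if "m < length ns" for m
    using letters[OF that] l len by (auto simp: nth_prepend split: if_splits)
  moreover have "\<beta> ! i \<in> initial_words (ns ! i) t"
    using init l len n initial_words_suffix[of "ns ! i" \<alpha> "\<beta> ! i" t]
    by (auto simp: nth_prepend split: if_splits)
  ultimately show "\<beta> \<in> initial_tuples ns i t"
    using len by (simp add: initial_tuples_def words_def)
qed

theorem corollary3p9:
  fixes ns :: "nat list" and t :: real
  assumes "\<forall>n\<in>set ns. 1 \<le> n"
    and "\<exists>n\<in>set ns. 2 \<le> n"
    and "0 \<le> t" and "t \<le> 1"
  shows "(\<exists>(H :: (nat list list \<Rightarrow> complex) hilb) T.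
            hilbert_space H \<and> T \<in> polyball H ns \<and> pure_tuple H ns T \<and>
            polyball_rank H ns T = 1 \<and>
            convergent (curv_seq H ns T) \<and> curv H ns T = complex_of_real t) \<and>
         (\<forall>s\<in>{0..1::real}. \<exists>N. invariant_subspace ns N \<and>
            convergent (multiplicity_seq ns N) \<and> inv_multiplicity ns N = complex_of_real s)"
proof -
  obtain i where i: "i < length ns" "2 \<le> ns ! i"
    using assms(2) by (auto simp: in_set_conv_nth)
  have average: "(\<lambda>m. 1 / of_nat ((m + length ns) choose length ns) *
      (\<Sum>q\<in>bounded_sum_lists (length ns) m.
        of_nat (card (multilevel ns q \<inter> initial_tuples ns i u)) / of_nat (card (multilevel ns q))))
      \<longlonglongrightarrow> complex_of_real u" if "0 \<le> u" "u \<le> 1" for u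
    unfolding initial_tuples_def
    by (rule multilevel_average_tendsto[OF assms(1) i(1) density_initial_words[OF i(2) that]])
  show ?thesis
  proof (intro conjI ballI)
    interpret hereditary_words ns "initial_tuples ns i t"
      using hereditary_initial_tuples[OF i assms(3)] .
    have "curv_seq (l2 (initial_tuples ns i t)) ns T \<longlonglongrightarrow> complex_of_real t"
      using average[OF assms(3,4)] by (simp only: curv_seq_T[abs_def])
    then have "convergent (curv_seq (l2 (initial_tuples ns i t)) ns T)"
        "curv (l2 (initial_tuples ns i t)) ns T = complex_of_real t"
      by (auto simp: curv_def intro: convergentI limI)
    then show "\<exists>(H :: (nat list list \<Rightarrow> complex) hilb) T.
            hilbert_space H \<and> T \<in> polyball H ns \<and> pure_tuple H ns T \<and>
            polyball_rank H ns T = 1 \<and>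
            convergent (curv_seq H ns T) \<and> curv H ns T = complex_of_real t"
      using hilbert_space_l2 T_in_polyball pure_T rank_T by blast
  next
    fix s :: real
    assume "s \<in> {0..1}"
    \<comment> \<open>The invariant subspace belongs to the complement of a hereditary set, so that
      set is given density \<open>1 - s\<close>.\<close>
    then have s: "0 \<le> 1 - s" "1 - s \<le> 1"
      by auto
    interpret hereditary_words ns "initial_tuples ns i (1 - s)"
      using hereditary_initial_tuples[OF i s(1)] .
    define J where "J = words ns - initial_tuples ns i (1 - s)"
    \<comment> \<open>Contraposition of heredity: if the longer tuple were in the hereditary set, so
      would be \<open>\<beta>\<close>.\<close>
    have "prepend l [j] \<beta> \<in> J" if "l < length ns" "j < ns ! l" "\<beta> \<in> J" for l j \<beta>
    proof -
      have "prepend l [j] \<beta> \<in> words ns"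
        using that by (auto simp: J_def words_def nth_prepend)
      then show ?thesis
        using that hereditary[OF that(1)] by (auto simp: J_def)
    qed
    then have inv: "invariant_subspace ns (car (l2 J))"
      by (intro invariant_subspace_l2) (auto simp: J_def)
    let ?A = "initial_words (ns ! i) (1 - s)"
    have "(\<lambda>l. real (card (level_words (ns ! i) l \<inter> - ?A)) / real (ns ! i ^ l)) \<longlonglongrightarrow> 1 - (1 - s)"
    proof (rule Lim_transform_eventually)
      show "(\<lambda>l. 1 - real (card (level_words (ns ! i) l \<inter> ?A)) / real (ns ! i ^ l)) \<longlonglongrightarrow> 1 - (1 - s)"
        by (intro tendsto_intros density_initial_words i s)
      have "card (level_words (ns ! i) l \<inter> ?A) + card (level_words (ns ! i) l \<inter> - ?A) = ns ! i ^ l" for l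
        using card_Un_disjoint[of "level_words (ns ! i) l \<inter> ?A" "level_words (ns ! i) l \<inter> - ?A"]
        by (simp add: finite_level_words card_level_words Int_Un_distrib[symmetric] disjoint_iff)
      then have "real (card (level_words (ns ! i) l \<inter> - ?A))
          = real (ns ! i ^ l) - real (card (level_words (ns ! i) l \<inter> ?A))" for l
        by (metis add_diff_cancel_left' of_nat_add)
      then show "eventually (\<lambda>l. 1 - real (card (level_words (ns ! i) l \<inter> ?A)) / real (ns ! i ^ l)
          = real (card (level_words (ns ! i) l \<inter> - ?A)) / real (ns ! i ^ l)) sequentially"
        using i by (auto simp: diff_divide_distrib)
    qed
    note multilevel_average_tendsto[OF assms(1) i(1) this]
    moreover have "{\<beta> \<in> words ns. \<beta> ! i \<in> - ?A} = J"
      by (auto simp: J_def initial_tuples_def)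
    moreover have "J \<subseteq> words ns"
      by (auto simp: J_def)
    ultimately have "multiplicity_seq ns (car (l2 J)) \<longlonglongrightarrow> complex_of_real (1 - (1 - s))"
      by (simp only: multiplicity_seq_l2[OF \<open>J \<subseteq> words ns\<close>, abs_def])
    then have "multiplicity_seq ns (car (l2 J)) \<longlonglongrightarrow> complex_of_real s"
      by simp
    then show "\<exists>N. invariant_subspace ns N \<and>
            convergent (multiplicity_seq ns N) \<and> inv_multiplicity ns N = complex_of_real s"
      using inv by (auto simp: inv_multiplicity_def intro!: exI[of _ "car (l2 J)"] intro: convergentI limI)
  qed
qed

end
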